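(* Assume that $(\Omega,\mathcal F_t,\mathrm P|_{\mathcal F_t})$ is atomless for every $t>0$, that $Y^*\in\mathcal L^1(\mathcal Q)$, and that $\sup_{\mathrm Q\in\mathcal Q}\mathbb E_{\mathrm Q}[Y^*\mathbb 1_{\{Y^*>a\}}]\to0$ as $a\to\infty$. Let $d$ be a totally bounded semimetric on $\mathcal Q$ such that the process $(d\mathrm Q/d\mathrm P)_{\mathrm Q\in\mathcal Q}$ has $\mathrm P$-almost surely $d$-uniformly continuous paths and is dominated by some $\mathrm P$-integrable random variable. Then $$\sup_{\tau\in\mathcal T}\inf_{\mathrm Q\in\mathcal Q}\mathbb E_{\mathrm Q}[Y_\tau]=\sup_{\tau\in\mathcal T}\inf_{\mathrm Q\in co(\mathcal Q)}\mathbb E_{\mathrm Q}[Y_\tau]=\inf_{\mathrm Q\in co(\mathcal Q)}\sup_{\tau\in\mathcal T}\mathbb E_{\mathrm Q}[Y_\tau].$$ If in addition $L^1(\Omega,\mathcal F_t,\mathrm P|_{\mathcal F_t})$ is weakly separable for every $t>0$, then $\mathcal Q$ is not time-consistent whenever $\mathcal Q$ has more than one element and all elements of $\mathcal Q$ are equivalent to $\mathrm P$.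
   Context: Let $0<T<\infty$ and let $(\Omega,\mathcal F,(\mathcal F_t)_{0\le t\le T},\mathrm P)$ be a filtered probability space with right-continuous filtration, $\mathcal F=\mathcal F_T$, and $\mathcal F_0$ containing only sets of probability $0$ or $1$ as well as all $\mathrm P$-null sets of $\mathcal F_T$. $\mathcal T$ denotes the set of all stopping times $\tau\le T$ w.r.t. $(\mathcal F_t)$. $\mathcal Q$ is a nonempty set of probability measures on $\mathcal F$, each absolutely continuous w.r.t. $\mathrm P$, and $co(\mathcal Q)$ is its convex hull. $\mathcal L^1(\mathcal Q)$ is the set of random variables $X$ with $\sup_{\mathrm Q\in\mathcal Q}\mathbb E_{\mathrm Q}[|X|]<\infty$. $Y=(Y_t)_{0\le t\le T}$ is a right-continuous $(\mathcal F_t)$-adapted process with bounded paths which is quasi left-uppersemicontinuous w.r.t. $\mathrm P$, i.e. $\limsup_n Y_{\tau_n}\le Y_\tau$ $\mathrm P$-a.s. whenever $\tau_n\in\mathcal T$, $\tau_n\nearrow\tau\in\mathcal T$. $Y^*:=\sup_{t\in[0,T]}|Y_t|$. The set $\mathcal Q$ is called time-consistent if for all $\tau,\sigma\in\mathcal T$ with $\tau\le\sigma$ and all $\mathrm P$-essentially bounded $X,Z$: $\operatorname{ess\,inf}_{\mathrm Q\in\mathcal Q}\mathbb E_{\mathrm Q}[X|\mathcal F_\sigma]\le\operatorname{ess\,inf}_{\mathrm Q\in\mathcal Q}\mathbb E_{\mathrm Q}[Z|\mathcal F_\sigma]$ implies $\operatorname{ess\,inf}_{\mathrm Q\in\mathcal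 Q}\mathbb E_{\mathrm Q}[X|\mathcal F_\tau]\le\operatorname{ess\,inf}_{\mathrm Q\in\mathcal Q}\mathbb E_{\mathrm Q}[Z|\mathcal F_\tau]$. *)

theory Defs
  imports "HOL-Probability.Probability"
begin

definition is_stopping_time ::
  "'a measure \<Rightarrow> (real \<Rightarrow> 'a measure) \<Rightarrow> real \<Rightarrow> ('a \<Rightarrow> real) \<Rightarrow> bool" where
  "is_stopping_time M F T \<tau> \<longleftrightarrow>
     (\<forall>\<omega>\<in>space M. 0 \<le> \<tau> \<omega> \<and> \<tau> \<omega> \<le> T) \<and>
     (\<forall>t\<in>{0..T}. {\<omega>\<in>space M. \<tau> \<omega> \<le> t} \<in> sets (F t))"

definition stopped_sigma ::
  "'a measure \<Rightarrow> (real \<Rightarrow> 'a measure) \<Rightarrow> real \<Rightarrow> ('a \<Rightarrow> real) \<Rightarrow> 'a measure" where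
  "stopped_sigma M F T \<sigma> = sigma (space M)
     {A \<in> sets M. \<forall>t\<in>{0..T}. A \<inter> {\<omega>\<in>space M. \<sigma> \<omega> \<le> t} \<in> sets (F t)}"

definition co_measures :: "'a measure \<Rightarrow> 'a measure set \<Rightarrow> 'a measure set" where
  "co_measures M Q = {N. sets N = sets M \<and>
     (\<exists>I w. finite I \<and> I \<subseteq> Q \<and> (\<forall>q\<in>I. 0 \<le> w q) \<and> sum w I = (1::real) \<and>
        (\<forall>A\<in>sets M. emeasure N A = (\<Sum>q\<in>I. ennreal (w q) * emeasure q A)))}"

definition is_ess_inf :: "'a measure \<Rightarrow> ('a \<Rightarrow> real) set \<Rightarrow> ('a \<Rightarrow> real) \<Rightarrow> bool" where
  "is_ess_inf M S \<eta> \<longleftrightarrow> \<eta> \<in> borel_measurable M \<and>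
     (\<forall>X\<in>S. AE \<omega> in M. \<eta> \<omega> \<le> X \<omega>) \<and>
     (\<forall>\<xi>\<in>borel_measurable M. (\<forall>X\<in>S. AE \<omega> in M. \<xi> \<omega> \<le> X \<omega>) \<longrightarrow> (AE \<omega> in M. \<xi> \<omega> \<le> \<eta> \<omega>))"

definition ess_bounded :: "'a measure \<Rightarrow> ('a \<Rightarrow> real) \<Rightarrow> bool" where
  "ess_bounded M X \<longleftrightarrow> X \<in> borel_measurable M \<and> (\<exists>C. AE \<omega> in M. \<bar>X \<omega>\<bar> \<le> C)"

definition is_ess_inf_cond_exp ::
  "'a measure \<Rightarrow> (real \<Rightarrow> 'a measure) \<Rightarrow> real \<Rightarrow> 'a measure set \<Rightarrow> ('a \<Rightarrow> real)
    \<Rightarrow> ('a \<Rightarrow> real) \<Rightarrow> ('a \<Rightarrow> real) \<Rightarrow> bool" where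
  "is_ess_inf_cond_exp M F T Q \<sigma> X \<eta> \<longleftrightarrow>
     is_ess_inf M ((\<lambda>q. real_cond_exp q (stopped_sigma M F T \<sigma>) X) ` Q) \<eta>"

definition time_consistent ::
  "'a measure \<Rightarrow> (real \<Rightarrow> 'a measure) \<Rightarrow> real \<Rightarrow> 'a measure set \<Rightarrow> bool" where
  "time_consistent M F T Q \<longleftrightarrow>
     (\<forall>\<tau> \<sigma> X Z. is_stopping_time M F T \<tau> \<and> is_stopping_time M F T \<sigma> \<and>
        (\<forall>\<omega>\<in>space M. \<tau> \<omega> \<le> \<sigma> \<omega>) \<and> ess_bounded M X \<and> ess_bounded M Z \<longrightarrow>
        (\<forall>a b c e. is_ess_inf_cond_exp M F T Q \<sigma> X a \<and> is_ess_inf_cond_exp M F T Q \<sigma> Z b \<and>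
            is_ess_inf_cond_exp M F T Q \<tau> X c \<and> is_ess_inf_cond_exp M F T Q \<tau> Z e \<and>
            (AE \<omega> in M. a \<omega> \<le> b \<omega>) \<longrightarrow> (AE \<omega> in M. c \<omega> \<le> e \<omega>)))"

definition atomless_measure :: "'a measure \<Rightarrow> bool" where
  "atomless_measure N \<longleftrightarrow> (\<forall>A\<in>sets N. 0 < emeasure N A \<longrightarrow>
     (\<exists>B\<in>sets N. B \<subseteq> A \<and> 0 < emeasure N B \<and> emeasure N B < emeasure N A))"

text \<open>Continuous linear functionals on L^1(N), evaluated on representatives.\<close>
definition L1_dual_functional :: "'a measure \<Rightarrow> (('a \<Rightarrow> real) \<Rightarrow> real) \<Rightarrow> bool" where
  "L1_dual_functional N \<phi> \<longleftrightarrow>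
     (\<forall>f g a b. integrable N f \<and> integrable N g \<longrightarrow>
        \<phi> (\<lambda>\<omega>. a * f \<omega> + b * g \<omega>) = a * \<phi> f + b * \<phi> g) \<and>
     (\<exists>C. \<forall>f. integrable N f \<longrightarrow> \<bar>\<phi> f\<bar> \<le> C * (\<integral>\<omega>. \<bar>f \<omega>\<bar> \<partial>N))"

definition weakly_separable_L1 :: "'a measure \<Rightarrow> bool" where
  "weakly_separable_L1 N \<longleftrightarrow>
     (\<exists>D. countable D \<and> (\<forall>d\<in>D. integrable N d) \<and>
        (\<forall>f. integrable N f \<longrightarrow> (\<forall>\<Phi>. finite \<Phi> \<and> (\<forall>\<phi>\<in>\<Phi>. L1_dual_functional N \<phi>) \<longrightarrow>
           (\<forall>\<epsilon>>0. \<exists>d\<in>D. \<forall>\<phi>\<in>\<Phi>. \<bar>\<phi> f - \<phi> d\<bar> < \<epsilon>))))"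

end

theory Submission
  imports Defs
begin

text \<open>
  Total boundedness of \<open>Q\<close>, uniform continuity and domination make the densities totally bounded in
  \<open>L\<^sup>1(P)\<close>; with uniform integrability of \<open>Y\<^sup>*\<close>, finitely many measures of \<open>Q\<close> suffice up to \<open>\<epsilon>\<close>.
  For finitely many measures the vectors of expected rewards \<open>E\<^sub>k[Y\<^sub>\<tau>]\<close> form an approximately convex
  set: after replacing \<open>\<tau>\<^sub>i\<close> by \<open>max \<tau>\<^sub>i t\<close> for a small \<open>t > 0\<close>, stopping times may be pasted along any
  event of \<open>F\<^sub>t\<close>, and an approximate Lyapunov theorem in the atomless space supplies the event. A
  finite-dimensional minimax theorem then gives the equalities.

  For the second part, two distinct measures have different conditional probabilities
  given some \<open>F\<^sub>t\<close>, \<open>t > 0\<close>. Hence there is a bounded \<open>U\<close>, supported on some \<open>B \<in> F\<^sub>t\<close>, such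
  that both \<open>U\<close> and \<open>-U\<close> have conditional lower expectation at most \<open>-\<delta>\<close> on \<open>B\<close>. Time consistency
  bounds the lower expectation of \<open>s U\<close> away from zero for all \<open>F\<^sub>t\<close>-measurable signs \<open>s\<close>, uniformly
  in \<open>s\<close>, whereas the Lyapunov theorem produces a sign making \<open>E\<^sub>q[s U]\<close> small for all \<open>q\<close> in a
  finite \<open>L\<^sup>1\<close>-net of \<open>Q\<close>.
\<close>

section \<open>Approximate Lyapunov convexity\<close>

text \<open>Information at time 0 is trivial, so stopping times cannot be mixed there; mixing uses
  events from a positive time, where atomlessness is available, and right-continuity of the paths
  makes the resulting delay cheap. Neither the supremum over stopping times nor the infimum over
  \<open>Q\<close> has to be attained, so the argument works up to tolerances. Approximate convexity
  is all that separation requires, because it already makes the closure of the set of reward vectors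
  convex. In the second part the decisive point is that the bound on the lower expectation does not
  depend on the sign: \<open>s U\<close> is compared with one fixed \<open>F t\<close>-measurable
  variable, namely \<open>- \<delta>\<close> on \<open>B\<close> and \<open>0\<close> elsewhere,
  whose lower expectation at time 0 is at most \<open>- \<delta> * q(B)\<close> for any fixed
  \<open>q\<close> in \<open>Q\<close>. The sign and the fineness of the net are chosen after this
  number is known, and then the two estimates collide.\<close>

text \<open>A proper split yields two positive parts, one of which has at most half the measure;
  iterating gives positive sets of geometrically decreasing measure.\<close>

lemma atomless_small_subset:
  assumes "finite_measure N" "atomless_measure N" "A \<in> sets N" "0 < measure N A" "0 < e"
  shows "\<exists>B\<in>sets N. B \<subseteq> A \<and> 0 < measure N B \<and> measure N B < e"
proof -
  interpret finite_measure N by fact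
  have *: "\<exists>B\<in>sets N. B \<subseteq> A \<and> 0 < measure N B \<and> measure N B \<le> measure N A / 2 ^ n" for n
  proof (induction n)
    case 0
    then show ?case using assms by auto
  next
    case (Suc n)
    then obtain B where B: "B \<in> sets N" "B \<subseteq> A" "0 < measure N B"
      "measure N B \<le> measure N A / 2 ^ n" by blast
    then obtain C where C: "C \<in> sets N" "C \<subseteq> B" "0 < measure N C" "measure N C < measure N B"
      using assms(2) unfolding atomless_measure_def
      by (metis B(1) B(3) emeasure_eq_measure ennreal_less_iff ennreal_0 measure_nonneg zero_le_numeral order_refl)
    have D: "measure N (B - C) = measure N B - measure N C"
      using B C by (intro finite_measure_Diff) auto
    show ?case
    proof (cases "measure N C \<le> measure N B / 2")
      case True
      then show ?thesis using B C by (intro bexI[of _ C]) auto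
    next
      case False
      then show ?thesis using B C D by (intro bexI[of _ "B - C"]) auto
    qed
  qed
  obtain n where "measure N A / e < 2 ^ n"
    using real_arch_pow[of 2 "measure N A / e"] by auto
  then have "measure N A / 2 ^ n < e"
    using assms(5) by (simp add: field_simps)
  moreover obtain B where "B \<in> sets N" "B \<subseteq> A" "0 < measure N B" "measure N B \<le> measure N A / 2 ^ n"
    using *[of n] by blast
  ultimately show ?thesis by (intro bexI[of _ B]) auto
qed

text \<open>A greedy construction in place of a maximality principle: the measure of each next set
  is within \<open>1 / (n + 1)\<close> of that of every admissible superset of \<open>S n\<close>.
  If the union stayed below \<open>c\<close>, a small positive piece of the remainder could be added
  to it; the enlarged set competes at every stage, so in the limit its measure could not exceed that
  of the union.\<close>

lemma atomless_subset_of_measure: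
  assumes "finite_measure N" "atomless_measure N" "A \<in> sets N" "0 \<le> c" "c \<le> measure N A"
  shows "\<exists>B\<in>sets N. B \<subseteq> A \<and> measure N B = c"
proof -
  interpret finite_measure N by fact
  let ?P = "\<lambda>S. S \<in> sets N \<and> S \<subseteq> A \<and> measure N S \<le> c"
  have "\<exists>S. \<forall>n. ?P (S n) \<and> S n \<subseteq> S (Suc n) \<and>
    (\<forall>C. ?P C \<and> S n \<subseteq> C \<longrightarrow> measure N C - 1 / (real n + 1) \<le> measure N (S (Suc n)))"
  proof (rule dependent_nat_choice)
    show "\<exists>x. ?P x" using assms(4) by (intro exI[of _ "{}"]) auto
  next
    fix S :: "'a set" and n
    assume S: "?P S"
    let ?X = "measure N ` {C. ?P C \<and> S \<subseteq> C}"
    have ne: "?X \<noteq> {}" and bd: "bdd_above ?X" using S by (auto intro!: bdd_aboveI[of _ c])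
    have "Sup ?X - 1 / (real n + 1) < Sup ?X" by simp
    then have "\<exists>x\<in>?X. Sup ?X - 1 / (real n + 1) < x"
      by (rule less_cSupD[OF ne])
    then obtain C where C': "C \<in> {C. ?P C \<and> S \<subseteq> C}" "Sup ?X - 1 / (real n + 1) < measure N C"
      unfolding Set.bex_simps(7) by (rule bexE)
    have C: "?P C" "S \<subseteq> C" "Sup ?X - 1 / (real n + 1) < measure N C"
      using C' by - (blast, blast, assumption)
    have "measure N C' - 1 / (real n + 1) \<le> measure N C" if "?P C' \<and> S \<subseteq> C'" for C'
    proof -
      have "measure N C' \<le> Sup ?X"
        using that by (intro cSup_upper[OF _ bd]) auto
      with C(3) show ?thesis by linarith
    qed
    with C(1,2) show "\<exists>S'. ?P S' \<and> S \<subseteq> S' \<and>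
       (\<forall>C. ?P C \<and> S \<subseteq> C \<longrightarrow> measure N C - 1 / (real n + 1) \<le> measure N S')"
      by blast
  qed
  then obtain S where S0: "\<forall>n. ?P (S n) \<and> S n \<subseteq> S (Suc n) \<and>
    (\<forall>C. ?P C \<and> S n \<subseteq> C \<longrightarrow> measure N C - 1 / (real n + 1) \<le> measure N (S (Suc n)))"
    by (rule exE)
  have S: "\<And>n. ?P (S n)" "\<And>n. S n \<subseteq> S (Suc n)"
    "\<And>n C. ?P C \<Longrightarrow> S n \<subseteq> C \<Longrightarrow> measure N C - 1 / (real n + 1) \<le> measure N (S (Suc n))"
    using S0 by presburger+
  define B where "B = (\<Union>n. S n)"
  have B: "B \<in> sets N" "B \<subseteq> A" unfolding B_def using S(1) by auto
  have lim: "(\<lambda>n. measure N (S n)) \<longlonglongrightarrow> measure N B"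
    unfolding B_def using S(1,2) by (intro finite_Lim_measure_incseq incseq_SucI) auto
  have le: "measure N B \<le> c"
    using lim S(1) by (intro LIMSEQ_le_const2) auto
  have "measure N B = c"
  proof (rule ccontr)
    assume "measure N B \<noteq> c"
    with le have lt: "measure N B < c" by simp
    have "measure N (A - B) = measure N A - measure N B"
      using B assms(3) by (intro finite_measure_Diff) auto
    then have "0 < measure N (A - B)" using lt assms(5) by linarith
    then obtain E where E: "E \<in> sets N" "E \<subseteq> A - B" "0 < measure N E" "measure N E < c - measure N B"
      using atomless_small_subset[OF assms(1,2), of "A - B" "c - measure N B"] B assms(3) lt by auto
    have m: "measure N (B \<union> E) = measure N B + measure N E"
      using B E by (intro finite_measure_Union) auto
    have *: "measure N (B \<union> E) - 1 / (real n + 1) \<le> measure N (S (Suc n))" for n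
    proof (rule S(3))
      show "?P (B \<union> E)" using B E m by auto
      show "S n \<subseteq> B \<union> E" unfolding B_def by auto
    qed
    have l1: "(\<lambda>n. measure N (B \<union> E) - 1 / (real n + 1)) \<longlonglongrightarrow> measure N (B \<union> E) - 0"
      using LIMSEQ_inverse_real_of_nat
      by (intro tendsto_intros) (simp add: field_simps inverse_eq_divide)
    have "measure N (B \<union> E) - 0 \<le> measure N B"
      using * by (intro LIMSEQ_le[OF l1 LIMSEQ_Suc[OF lim]]) auto
    then show False using m E by simp
  qed
  then show ?thesis using B by blast
qed

text \<open>The definition of the Bochner integral already supplies simple functions converging in
  mean, so it is unfolded.\<close>

lemma integrable_simple_approx:
  fixes f :: "'a \<Rightarrow> real"
  assumes "integrable N f" "0 < e"
  shows "\<exists>s. simple_function N s \<and> integrable N s \<and> (\<integral>x. \<bar>f x - s x\<bar> \<partial>N) < e"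
proof -
  obtain x where "has_bochner_integral N f x"
    using assms(1) by (auto simp: integrable.simps)
  then obtain s where s: "\<And>i. Bochner_Integration.simple_bochner_integrable N (s i)"
    "(\<lambda>i. \<integral>\<^sup>+ x. ennreal (norm (f x - s i x)) \<partial>N) \<longlonglongrightarrow> 0"
    by (auto simp del: real_norm_def elim!: has_bochner_integral.cases)
  have "\<forall>\<^sub>F i in sequentially. (\<integral>\<^sup>+ x. ennreal (norm (f x - s i x)) \<partial>N) < ennreal e"
    using order_tendstoD(2)[OF s(2), of "ennreal e"] assms(2) by simp
  then obtain i where i: "(\<integral>\<^sup>+ x. ennreal (norm (f x - s i x)) \<partial>N) < ennreal e"
    by (auto simp: eventually_sequentially)
  have int: "integrable N (s i)"
    using s(1) has_bochner_integral_simple_bochner_integrable integrable.intros by blast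
  have "ennreal (\<integral>x. \<bar>f x - s i x\<bar> \<partial>N) = (\<integral>\<^sup>+ x. ennreal (norm (f x - s i x)) \<partial>N)"
    using assms(1) int by (subst nn_integral_eq_integral) auto
  with i have "ennreal (\<integral>x. \<bar>f x - s i x\<bar> \<partial>N) < ennreal e"
    by (simp only:)
  then have "(\<integral>x. \<bar>f x - s i x\<bar> \<partial>N) < e"
    by (subst (asm) ennreal_less_iff) auto
  then show ?thesis
    using int s(1)[of i] by (auto simp: simple_bochner_integrable.simps)
qed

text \<open>For simple functions the scaling is exact: on a common finite partition into level sets,
  take from every cell a subset of \<open>l\<close> times its measure. Passing back to
  \<open>f\<close> costs the approximation error twice, once on the chosen set and once in the full
  integral; hence the tolerance \<open>e / 2\<close>.\<close>

lemma atomless_approx_convexity: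
  fixes f :: "'j \<Rightarrow> 'a \<Rightarrow> real"
  assumes "finite_measure N" "atomless_measure N" "finite J"
    and int: "\<And>j. j \<in> J \<Longrightarrow> integrable N (f j)"
    and l: "0 \<le> l" "l \<le> 1" and e: "0 < e"
  shows "\<exists>C\<in>sets N. \<forall>j\<in>J. \<bar>(\<integral>x. indicator C x * f j x \<partial>N) - l * (\<integral>x. f j x \<partial>N)\<bar> < e"
proof -
  interpret finite_measure N by fact
  have "\<forall>j\<in>J. \<exists>s. simple_function N s \<and> integrable N s \<and> (\<integral>x. \<bar>f j x - s x\<bar> \<partial>N) < e / 2"
    by (intro ballI integrable_simple_approx[OF int]) (use e in auto)
  from bchoice[OF this] obtain s where s0:
    "\<forall>j\<in>J. simple_function N (s j) \<and> integrable N (s j) \<and> (\<integral>x. \<bar>f j x - s j x\<bar> \<partial>N) < e / 2"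
    by (rule exE)
  have s: "\<And>j. j \<in> J \<Longrightarrow> simple_function N (s j)"
    "\<And>j. j \<in> J \<Longrightarrow> integrable N (s j)" "\<And>j. j \<in> J \<Longrightarrow> (\<integral>x. \<bar>f j x - s j x\<bar> \<partial>N) < e / 2"
    using s0 by blast+
  \<comment> \<open>One function-valued map collects all values, so its fibres form the common
    partition; restricting to \<open>J\<close> fixes the values outside \<open>J\<close>, which
    keeps the range finite.\<close>
  define S where "S x = (\<lambda>j\<in>J. s j x)" for x
  define V where "V = S ` space N"
  define B where "B v = {x \<in> space N. S x = v}" for v
  have "V \<subseteq> (\<Pi>\<^sub>E j\<in>J. s j ` space N)"
    unfolding V_def S_def by auto
  moreover have "finite (\<Pi>\<^sub>E j\<in>J. s j ` space N)"
    using assms(3) s(1) by (intro finite_PiE) (auto dest: simple_functionD)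
  ultimately have finV: "finite V" by (rule finite_subset)
  have B: "B v \<in> sets N" if "v \<in> V" for v
  proof -
    have "B v = {x \<in> space N. \<forall>j\<in>J. s j x = v j}"
      using that unfolding B_def V_def S_def by (auto simp: fun_eq_iff restrict_def)
    moreover have "s j \<in> borel_measurable N" if "j \<in> J" for j
      using s(2)[OF that] by auto
    then have "{x \<in> space N. \<forall>j\<in>J. s j x = v j} \<in> sets N"
      using assms(3) by (intro sets.sets_Collect_finite_All) auto
    ultimately show ?thesis by simp
  qed
  have "\<exists>C\<in>sets N. C \<subseteq> B v \<and> measure N C = l * measure N (B v)" if "v \<in> V" for v
    using atomless_subset_of_measure[OF assms(1,2) B[OF that], of "l * measure N (B v)"] l
    by (simp add: mult_left_le_one_le)
  then obtain C where C: "\<And>v. v \<in> V \<Longrightarrow> C v \<in> sets N" "\<And>v. v \<in> V \<Longrightarrow> C v \<subseteq> B v"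
    "\<And>v. v \<in> V \<Longrightarrow> measure N (C v) = l * measure N (B v)"
    by metis
  \<comment> \<open>Stated for arbitrary subsets of the cells because it serves twice: for the
    chosen pieces \<open>C\<close> and for the full cells \<open>B\<close>.\<close>
  have sum: "(\<integral>x. indicator (\<Union>v\<in>V. E v) x * s j x \<partial>N) = (\<Sum>v\<in>V. v j * measure N (E v))"
    if E: "\<And>v. v \<in> V \<Longrightarrow> E v \<in> sets N" "\<And>v. v \<in> V \<Longrightarrow> E v \<subseteq> B v" and j: "j \<in> J" for E j
  proof -
    have "indicator (\<Union>v\<in>V. E v) x * s j x = (\<Sum>v\<in>V. v j * indicator (E v) x)" if x: "x \<in> space N" for x
    proof -
      have V: "S x \<in> V" using x by (simp add: V_def)
      have 0: "x \<notin> E v" if "v \<in> V" "v \<noteq> S x" for v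
        using E(2)[OF that(1)] that(2) unfolding B_def by auto
      have "(\<Sum>v\<in>V. v j * indicator (E v) x) = (\<Sum>v\<in>{S x}. v j * indicator (E v) x :: real)"
        using finV V 0 by (intro sum.mono_neutral_right) auto
      moreover have "(\<Sum>v\<in>{S x}. g v) = g (S x)" for g :: "_ \<Rightarrow> real"
        by simp
      ultimately have "(\<Sum>v\<in>V. v j * indicator (E v) x) = S x j * indicator (E (S x)) x"
        by (simp only:)
      moreover have "indicator (\<Union>v\<in>V. E v) x = (indicator (E (S x)) x :: real)"
        using 0 V by (auto simp: indicator_def)
      moreover have "S x j = s j x" using j by (simp add: S_def)
      ultimately show ?thesis by (simp only: mult.commute)
    qed
    then have "(\<integral>x. indicator (\<Union>v\<in>V. E v) x * s j x \<partial>N) = (\<integral>x. (\<Sum>v\<in>V. v j * indicator (E v) x) \<partial>N)"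
      by (intro Bochner_Integration.integral_cong) auto
    also have "\<dots> = (\<Sum>v\<in>V. v j * measure N (E v))"
      using E(1) by (subst Bochner_Integration.integral_sum) (auto simp: emeasure_eq_measure)
    finally show ?thesis .
  qed
  define D where "D = (\<Union>v\<in>V. C v)"
  have D: "D \<in> sets N" unfolding D_def using finV C(1) by auto
  have "\<bar>(\<integral>x. indicator D x * f j x \<partial>N) - l * (\<integral>x. f j x \<partial>N)\<bar> < e" if j: "j \<in> J" for j
  proof -
    have "(\<Union>v\<in>V. B v) = space N" unfolding V_def B_def by auto
    then have "(\<integral>x. s j x \<partial>N) = (\<integral>x. indicator (\<Union>v\<in>V. B v) x * s j x \<partial>N)"
      by (intro Bochner_Integration.integral_cong) auto
    also have "\<dots> = (\<Sum>v\<in>V. v j * measure N (B v))" using sum[OF B _ j] by simp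
    finally have eq: "(\<integral>x. indicator D x * s j x \<partial>N) = l * (\<integral>x. s j x \<partial>N)"
      unfolding D_def using sum[OF C(1,2) j] C(3) by (simp add: sum_distrib_left ac_simps)
    have i1: "integrable N (\<lambda>x. indicator D x * f j x)" "integrable N (\<lambda>x. indicator D x * s j x)"
      using integrable_mult_indicator[OF D int[OF j]] integrable_mult_indicator[OF D s(2)[OF j]] by auto
    have "\<bar>(\<integral>x. indicator D x * f j x \<partial>N) - (\<integral>x. indicator D x * s j x \<partial>N)\<bar>
        = \<bar>\<integral>x. indicator D x * f j x - indicator D x * s j x \<partial>N\<bar>"
      using i1 by simp
    also have "\<dots> \<le> (\<integral>x. \<bar>indicator D x * f j x - indicator D x * s j x\<bar> \<partial>N)"
      by (rule integral_abs_bound)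
    also have "\<dots> \<le> (\<integral>x. \<bar>f j x - s j x\<bar> \<partial>N)"
      using i1 int[OF j] s(2)[OF j] by (intro integral_mono integrable_abs Bochner_Integration.integrable_diff)
        (auto simp: indicator_def)
    finally have a: "\<bar>(\<integral>x. indicator D x * f j x \<partial>N) - (\<integral>x. indicator D x * s j x \<partial>N)\<bar> < e / 2"
      using s(3)[OF j] by simp
    have "\<bar>(\<integral>x. s j x \<partial>N) - (\<integral>x. f j x \<partial>N)\<bar> = \<bar>\<integral>x. f j x - s j x \<partial>N\<bar>"
      using int[OF j] s(2)[OF j] by (simp add: abs_minus_commute)
    also have "\<dots> < e / 2"
      using integral_abs_bound[of N "\<lambda>x. f j x - s j x"] s(3)[OF j] by linarith
    finally have "l * \<bar>(\<integral>x. s j x \<partial>N) - (\<integral>x. f j x \<partial>N)\<bar> \<le> 1 * (e / 2)"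
      using l by (intro mult_mono) auto
    then have "\<bar>l * (\<integral>x. s j x \<partial>N) - l * (\<integral>x. f j x \<partial>N)\<bar> \<le> e / 2"
      using l by (simp add: abs_mult right_diff_distrib[symmetric])
    then show ?thesis using a eq by linarith
  qed
  then show ?thesis using D by blast
qed

text \<open>The integrands need not be measurable for \<open>G\<close>; their conditional
  expectations are, and over a set of \<open>G\<close> both have the same integral.\<close>

lemma atomless_subalg_approx_convexity:
  fixes f :: "'j \<Rightarrow> 'a \<Rightarrow> real"
  assumes "finite_measure M" and G: "subalgebra M G" and "atomless_measure (restr_to_subalg M G)"
    and "finite J" and int: "\<And>j. j \<in> J \<Longrightarrow> integrable M (f j)"
    and l: "0 \<le> l" "l \<le> 1" and e: "0 < e"
  shows "\<exists>C\<in>sets G. \<forall>j\<in>J. \<bar>(\<integral>x. indicator C x * f j x \<partial>M) - l * (\<integral>x. f j x \<partial>M)\<bar> < e"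
proof -
  let ?N = "restr_to_subalg M G"
  interpret finite_measure M by fact
  interpret finite_measure_subalgebra M G
    by standard (rule G)
  have N: "finite_measure ?N" using finite_measure_restr_to_subalg[OF G assms(1)] .
  have "integrable ?N (real_cond_exp M G (f j))" if "j \<in> J" for j
    using int[OF that] by (intro integrable_in_subalg[OF G] real_cond_exp_int) auto
  then obtain C where C: "C \<in> sets ?N" "\<And>j. j \<in> J \<Longrightarrow>
    \<bar>(\<integral>x. indicator C x * real_cond_exp M G (f j) x \<partial>?N) - l * (\<integral>x. real_cond_exp M G (f j) x \<partial>?N)\<bar> < e"
    using atomless_approx_convexity[OF N assms(3,4) _ l e, of "\<lambda>j. real_cond_exp M G (f j)"] by blast
  have CG: "C \<in> sets G" using C(1) sets_restr_to_subalg[OF G] by simp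
  then have CM: "C \<in> sets M" using G by (auto simp: subalgebra_def)
  have "\<bar>(\<integral>x. indicator C x * f j x \<partial>M) - l * (\<integral>x. f j x \<partial>M)\<bar> < e" if j: "j \<in> J" for j
  proof -
    have fm: "f j \<in> borel_measurable M" using int[OF j] by auto
    have ci: "(indicator C :: _ \<Rightarrow> real) \<in> borel_measurable G" using CG by simp
    have "(\<integral>x. real_cond_exp M G (f j) x \<partial>?N) = (\<integral>x. f j x \<partial>M)"
      using real_cond_exp_int(2)[OF int[OF j]] by (subst integral_subalgebra2[OF G]) auto
    moreover have "(\<integral>x. indicator C x * real_cond_exp M G (f j) x \<partial>?N)
        = (\<integral>x. indicator C x * real_cond_exp M G (f j) x \<partial>M)"
      using ci by (intro integral_subalgebra2[OF G]) auto
    moreover have "\<dots> = (\<integral>x. indicator C x * f j x \<partial>M)"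
      using integrable_mult_indicator[OF CM int[OF j]] fm ci by (intro real_cond_exp_intg) auto
    ultimately show ?thesis using C(2)[OF j] by simp
  qed
  then show ?thesis using CG by blast
qed

section \<open>Finite minimax\<close>

text \<open>Approximate convexity makes the closure of the planar image convex, and this closure
  misses the open quadrant above \<open>(c, c)\<close>. A separating line has a normal with
  nonnegative entries because the quadrant is unbounded in both directions; normalising it yields
  the weight.\<close>

lemma two_point_minimax:
  fixes a b :: "'v \<Rightarrow> real"
  assumes approx: "\<And>u v l e. u \<in> V \<Longrightarrow> v \<in> V \<Longrightarrow> 0 \<le> l \<Longrightarrow> l \<le> 1 \<Longrightarrow> 0 < e \<Longrightarrow>
      \<exists>z\<in>V. \<bar>a z - (l * a u + (1 - l) * a v)\<bar> < e \<and> \<bar>b z - (l * b u + (1 - l) * b v)\<bar> < e"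
    and le: "\<And>v. v \<in> V \<Longrightarrow> a v \<le> c \<or> b v \<le> c"
  shows "\<exists>l. 0 \<le> l \<and> l \<le> 1 \<and> (\<forall>v\<in>V. l * a v + (1 - l) * b v \<le> c)"
proof (cases "V = {}")
  case True
  then show ?thesis by (intro exI[of _ 0]) auto
next
  case False
  define S where "S = (\<lambda>v. (a v, b v)) ` V"
  define R where "R = {c<..} \<times> {c<..}"
  have near: "\<exists>z\<in>S. dist z (l *\<^sub>R p + (1 - l) *\<^sub>R q) < e"
    if pq: "p \<in> S" "q \<in> S" and l: "0 \<le> l" "l \<le> 1" and e: "0 < e" for p q l e
  proof -
    obtain u v where uv: "u \<in> V" "v \<in> V" "p = (a u, b u)" "q = (a v, b v)"
      using pq unfolding S_def by blast
    obtain z where z: "z \<in> V" "\<bar>a z - (l * a u + (1 - l) * a v)\<bar> < e / 2"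
      "\<bar>b z - (l * b u + (1 - l) * b v)\<bar> < e / 2"
      using approx[OF uv(1,2) l, of "e / 2"] e by auto
    have "dist (a z, b z) (l *\<^sub>R p + (1 - l) *\<^sub>R q) =
        sqrt ((a z - (l * a u + (1 - l) * a v))\<^sup>2 + (b z - (l * b u + (1 - l) * b v))\<^sup>2)"
      using uv by (simp add: dist_Pair_Pair dist_real_def)
    also have "\<dots> \<le> \<bar>a z - (l * a u + (1 - l) * a v)\<bar> + \<bar>b z - (l * b u + (1 - l) * b v)\<bar>"
      by (rule sqrt_sum_squares_le_sum_abs)
    also have "\<dots> < e" using z by linarith
    finally show ?thesis using z(1) unfolding S_def by blast
  qed
  have conv: "convex (closure S)"
    unfolding convex_alt
  proof (intro ballI allI impI)
    fix p q and l :: real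
    assume pq: "p \<in> closure S" "q \<in> closure S" and l: "0 \<le> l \<and> l \<le> 1"
    show "(1 - l) *\<^sub>R p + l *\<^sub>R q \<in> closure S"
      unfolding closure_approachable
    proof (intro allI impI)
      fix e :: real assume e: "0 < e"
      obtain p' q' where p': "p' \<in> S" "dist p' p < e / 2" and q': "q' \<in> S" "dist q' q < e / 2"
        using pq e unfolding closure_approachable by (meson half_gt_zero)
      obtain z where z: "z \<in> S" "dist z ((1 - l) *\<^sub>R p' + (1 - (1 - l)) *\<^sub>R q') < e / 2"
        using near[OF p'(1) q'(1), of "1 - l" "e / 2"] l e by auto
      have "norm (((1 - l) *\<^sub>R p' + l *\<^sub>R q') - ((1 - l) *\<^sub>R p + l *\<^sub>R q))
          = norm ((1 - l) *\<^sub>R (p' - p) + l *\<^sub>R (q' - q))"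
        by (simp add: algebra_simps)
      also have "\<dots> \<le> (1 - l) * norm (p' - p) + l * norm (q' - q)"
        using l by (intro order_trans[OF norm_triangle_ineq]) auto
      also have "\<dots> \<le> (1 - l) * (e / 2) + l * (e / 2)"
        using p' q' l by (intro add_mono mult_left_mono) (auto simp: dist_norm)
      also have "\<dots> = e / 2" by (simp add: field_simps)
      finally have "dist ((1 - l) *\<^sub>R p' + l *\<^sub>R q') ((1 - l) *\<^sub>R p + l *\<^sub>R q) \<le> e / 2"
        by (simp add: dist_norm)
      then have "dist z ((1 - l) *\<^sub>R p + l *\<^sub>R q) < e"
        using z(2) dist_triangle[of z "(1 - l) *\<^sub>R p + l *\<^sub>R q" "(1 - l) *\<^sub>R p' + l *\<^sub>R q'"] by simp
      then show "\<exists>y\<in>S. dist y ((1 - l) *\<^sub>R p + l *\<^sub>R q) < e" using z(1) by blast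
    qed
  qed
  \<comment> \<open>Openness of the quadrant lets disjointness pass from the image to its
    closure.\<close>
  have "open R" unfolding R_def by (intro open_Times) auto
  moreover have "S \<inter> R = {}" unfolding S_def R_def using le by fastforce
  ultimately have disj: "closure S \<inter> R = {}"
    by (simp add: Int_commute open_Int_closure_eq_empty)
  have "convex R" unfolding R_def by (intro convex_Times) auto
  moreover have "R \<noteq> {}" unfolding R_def using gt_ex by auto
  moreover have "closure S \<noteq> {}" using False by (simp add: S_def)
  ultimately obtain n k where n: "n \<noteq> 0" "\<forall>x\<in>closure S. n \<bullet> x \<le> k" "\<forall>x\<in>R. n \<bullet> x \<ge> k"
    using separating_hyperplane_sets[OF conv _ _ _ disj] by blast
  obtain n1 n2 where nn: "n = (n1, n2)" by (cases n)
  have R: "k \<le> n1 * x + n2 * y" if "c < x" "c < y" for x y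
    using n(3) that unfolding R_def nn by auto
  have pos: "0 \<le> w" if "\<And>t. 0 < t \<Longrightarrow> k \<le> w * t + B" for w B
  proof (rule ccontr)
    assume "\<not> 0 \<le> w"
    \<comment> \<open>This \<open>t\<close> turns the right-hand side into
      \<open>B - 1 - \<bar>k - B\<bar>\<close>, which lies below \<open>k\<close>.\<close>
    then have "k \<le> w * ((1 + \<bar>k - B\<bar>) / (- w)) + B"
      by (intro that divide_pos_pos) auto
    then show False using \<open>\<not> 0 \<le> w\<close> by simp
  qed
  have n1: "0 \<le> n1"
    using R[of "c + t" "c + 1" for t] by (intro pos[of n1 "n1 * c + n2 * (c + 1)"]) (simp add: algebra_simps)
  have n2: "0 \<le> n2"
    using R[of "c + 1" "c + t" for t] by (intro pos[of n2 "n2 * c + n1 * (c + 1)"]) (simp add: algebra_simps)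
  have s: "0 < n1 + n2" using n1 n2 n(1) nn by (auto simp: zero_prod_def)
  \<comment> \<open>The corner \<open>(c, c)\<close> is outside the open quadrant, so it is
    approached along the diagonal.\<close>
  have kc: "k \<le> (n1 + n2) * c"
  proof (rule field_le_epsilon)
    fix e :: real assume "0 < e"
    then have "k \<le> n1 * (c + e / (n1 + n2)) + n2 * (c + e / (n1 + n2))"
      using s by (intro R) auto
    also have "\<dots> = (n1 + n2) * c + (n1 + n2) * (e / (n1 + n2))"
      by (simp only: algebra_simps)
    finally show "k \<le> (n1 + n2) * c + e" using s by simp
  qed
  have "n1 / (n1 + n2) * a v + (1 - n1 / (n1 + n2)) * b v \<le> c" if "v \<in> V" for v
  proof -
    have "(a v, b v) \<in> closure S" using that closure_subset[of S] unfolding S_def by auto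
    then have "n1 * a v + n2 * b v \<le> (n1 + n2) * c" using n(2) kc nn by force
    moreover have "1 - n1 / (n1 + n2) = n2 / (n1 + n2)"
      using s by (simp add: field_simps)
    then have "n1 / (n1 + n2) * a v + (1 - n1 / (n1 + n2)) * b v = (n1 * a v + n2 * b v) / (n1 + n2)"
      by (simp add: add_divide_distrib)
    ultimately show ?thesis using s by (simp add: divide_le_eq mult.commute)
  qed
  then show ?thesis using n1 n2 s by (intro exI[of _ "n1 / (n1 + n2)"]) auto
qed

text \<open>
  The induction step restricts \<open>V\<close> to the points where the new payoff exceeds the level; this set
  inherits approximate convexity, so the remaining payoffs can be merged into a single one.
\<close>

lemma finite_minimax:
  fixes g :: "'k \<Rightarrow> 'v \<Rightarrow> real"
  assumes "finite K" "K \<noteq> {}"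
    and "\<And>u v l e. u \<in> V \<Longrightarrow> v \<in> V \<Longrightarrow> 0 \<le> l \<Longrightarrow> l \<le> 1 \<Longrightarrow> 0 < e \<Longrightarrow>
      \<exists>z\<in>V. \<forall>k\<in>K. \<bar>g k z - (l * g k u + (1 - l) * g k v)\<bar> < e"
    and "\<And>v. v \<in> V \<Longrightarrow> \<exists>k\<in>K. g k v \<le> c"
  shows "\<exists>w. (\<forall>k\<in>K. 0 \<le> w k) \<and> sum w K = 1 \<and> (\<forall>v\<in>V. (\<Sum>k\<in>K. w k * g k v) \<le> c)"
  using assms
proof (induction K arbitrary: V rule: finite_ne_induct)
  case (singleton k)
  then show ?case by (intro exI[of _ "\<lambda>_. 1"]) auto
next
  case (insert k K)
  define V' where "V' = {v\<in>V. c < g k v}"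
  have "\<exists>w. (\<forall>k\<in>K. 0 \<le> w k) \<and> sum w K = 1 \<and> (\<forall>v\<in>V'. (\<Sum>k\<in>K. w k * g k v) \<le> c)"
  proof (rule insert.IH)
    fix u v and l e :: real
    assume uv: "u \<in> V'" "v \<in> V'" and l: "0 \<le> l" "l \<le> 1" and e: "0 < e"
    let ?m = "l * g k u + (1 - l) * g k v"
    have "c < ?m"
    proof (cases "l = 0")
      case False
      then have "l * c < l * g k u" using uv l by (simp add: V'_def)
      moreover have "(1 - l) * c \<le> (1 - l) * g k v" using uv l by (intro mult_left_mono) (auto simp: V'_def)
      ultimately show ?thesis by (simp add: algebra_simps)
    qed (use uv in \<open>simp add: V'_def\<close>)
    \<comment> \<open>The tolerance is also kept below the slack \<open>?m - c\<close>, so that the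
      approximating point stays in \<open>V'\<close>.\<close>
    then obtain z where "z \<in> V" "\<forall>j\<in>insert k K. \<bar>g j z - (l * g j u + (1 - l) * g j v)\<bar> < min e (?m - c)"
      using insert.prems(1)[of u v l "min e (?m - c)"] uv l e by (auto simp: V'_def)
    moreover then have "c < g k z" by (auto simp: abs_less_iff)
    ultimately show "\<exists>z\<in>V'. \<forall>k\<in>K. \<bar>g k z - (l * g k u + (1 - l) * g k v)\<bar> < e"
      unfolding V'_def by (intro bexI[of _ z]) auto
  next
    fix v assume "v \<in> V'"
    then show "\<exists>k\<in>K. g k v \<le> c" using insert.prems(2)[of v] by (auto simp: V'_def)
  qed
  then obtain w where w: "\<And>k. k \<in> K \<Longrightarrow> 0 \<le> w k" "sum w K = 1"
    "\<And>v. v \<in> V' \<Longrightarrow> (\<Sum>k\<in>K. w k * g k v) \<le> c" by auto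
  \<comment> \<open>With the old payoffs merged under the weights \<open>w\<close>, only two payoffs
    remain; since these weights sum to one, the merged payoff inherits the tolerance.\<close>
  have "\<exists>l. 0 \<le> l \<and> l \<le> 1 \<and> (\<forall>v\<in>V. l * g k v + (1 - l) * (\<Sum>k\<in>K. w k * g k v) \<le> c)"
  proof (rule two_point_minimax)
    fix u v and l e :: real
    assume *: "u \<in> V" "v \<in> V" "0 \<le> l" "l \<le> 1" "0 < e"
    obtain z where z: "z \<in> V" "\<And>j. j \<in> insert k K \<Longrightarrow> \<bar>g j z - (l * g j u + (1 - l) * g j v)\<bar> < e / 2"
      using insert.prems(1)[OF *(1-4), of "e / 2"] *(5) by auto
    have "\<bar>(\<Sum>k\<in>K. w k * g k z) - (l * (\<Sum>k\<in>K. w k * g k u) + (1 - l) * (\<Sum>k\<in>K. w k * g k v))\<bar>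
        = \<bar>\<Sum>k\<in>K. w k * (g k z - (l * g k u + (1 - l) * g k v))\<bar>"
      by (simp add: sum_distrib_left sum_subtractf sum.distrib right_diff_distrib distrib_left
        mult.left_commute)
    also have "\<dots> \<le> (\<Sum>k\<in>K. w k * (e / 2))"
    proof (intro order_trans[OF sum_abs] sum_mono)
      fix i assume "i \<in> K"
      then show "\<bar>w i * (g i z - (l * g i u + (1 - l) * g i v))\<bar> \<le> w i * (e / 2)"
        using mult_left_mono[OF less_imp_le[OF z(2)[of i]] w(1)[of i]] w(1)[of i]
        by (simp add: abs_mult)
    qed
    also have "\<dots> < e" using w(2) *(5) by (simp flip: sum_divide_distrib sum_distrib_right)
    finally show "\<exists>z\<in>V. \<bar>g k z - (l * g k u + (1 - l) * g k v)\<bar> < e \<and>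
      \<bar>(\<Sum>k\<in>K. w k * g k z) - (l * (\<Sum>k\<in>K. w k * g k u) + (1 - l) * (\<Sum>k\<in>K. w k * g k v))\<bar> < e"
      using z(1) z(2)[of k] *(5) by (intro bexI[of _ z]) auto
  next
    fix v assume "v \<in> V"
    then show "g k v \<le> c \<or> (\<Sum>k\<in>K. w k * g k v) \<le> c" using w(3)[of v] unfolding V'_def by fastforce
  qed
  then obtain l where l: "0 \<le> l" "l \<le> 1" "\<forall>v\<in>V. l * g k v + (1 - l) * (\<Sum>k\<in>K. w k * g k v) \<le> c"
    by blast
  define w' where "w' j = (if j = k then l else (1 - l) * w j)" for j
  have K: "(\<Sum>j\<in>K. h (w' j) j) = (\<Sum>j\<in>K. h ((1 - l) * w j) j)" for h :: "real \<Rightarrow> 'k \<Rightarrow> real"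
    using insert.hyps by (intro sum.cong) (auto simp: w'_def)
  have "sum w' (insert k K) = 1"
    using insert.hyps K[of "\<lambda>x _. x"] w(2) by (simp add: w'_def[of k] flip: sum_distrib_left)
  moreover have "(\<Sum>j\<in>insert k K. w' j * g j v) = l * g k v + (1 - l) * (\<Sum>k\<in>K. w k * g k v)" for v
    using insert.hyps K[of "\<lambda>x j. x * g j v"] by (simp add: w'_def[of k] sum_distrib_left ac_simps)
  moreover have "\<forall>j\<in>insert k K. 0 \<le> w' j" using l w(1) by (auto simp: w'_def)
  ultimately show ?case using l(3) by (intro exI[of _ w']) auto
qed

section \<open>Stopped processes\<close>

lemma
  fixes g f :: "'a \<Rightarrow> real"
  assumes "q = density M (\<lambda>x. ennreal (g x))" "g \<in> borel_measurable M" "\<forall>x\<in>space M. 0 \<le> g x"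
    "f \<in> borel_measurable M"
  shows integral_wrt_density: "(\<integral>x. f x \<partial>q) = (\<integral>x. g x * f x \<partial>M)"
    and integrable_wrt_density: "integrable q f \<longleftrightarrow> integrable M (\<lambda>x. g x * f x)"
  using assms(2-4) unfolding assms(1)
  by (auto simp: integral_density integrable_density)

text \<open>The modulus of continuity depends on the outcome; dominated convergence turns it into a
  modulus in mean. Arguing by contradiction along a sequence of pairs avoids a supremum over the
  possibly uncountable \<open>Q\<close>, whose measurability would be unclear.\<close>

lemma finite_L1_net:
  fixes D :: "'q \<Rightarrow> 'a \<Rightarrow> real" and d :: "'q \<Rightarrow> 'q \<Rightarrow> real"
  assumes ne: "Q \<noteq> {}" and int: "\<And>q. q \<in> Q \<Longrightarrow> integrable M (D q)"
    and tb: "\<forall>e>0. \<exists>K. finite K \<and> K \<subseteq> Q \<and> Q \<subseteq> (\<Union>k\<in>K. {q\<in>Q. d k q < e})"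
    and uc: "AE x in M. \<forall>e>0. \<exists>\<delta>>0. \<forall>p\<in>Q. \<forall>q\<in>Q. d p q < \<delta> \<longrightarrow> \<bar>D p x - D q x\<bar> < e"
    and dom: "integrable M h" "AE x in M. \<forall>q\<in>Q. \<bar>D q x\<bar> \<le> h x"
    and e: "0 < e"
  shows "\<exists>K. finite K \<and> K \<noteq> {} \<and> K \<subseteq> Q \<and> (\<forall>q\<in>Q. \<exists>k\<in>K. (\<integral>x. \<bar>D q x - D k x\<bar> \<partial>M) < e)"
proof -
  have "\<exists>\<delta>>0. \<forall>p\<in>Q. \<forall>q\<in>Q. d p q < \<delta> \<longrightarrow> (\<integral>x. \<bar>D p x - D q x\<bar> \<partial>M) < e"
  proof (rule ccontr)
    assume "\<not> ?thesis"
    then have "\<exists>p q. p \<in> Q \<and> q \<in> Q \<and> d p q < \<delta> \<and> e \<le> (\<integral>x. \<bar>D p x - D q x\<bar> \<partial>M)" if "0 < \<delta>" for \<delta>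
      using that by (meson not_less)
    then have "\<forall>n. \<exists>pq. fst pq \<in> Q \<and> snd pq \<in> Q \<and> d (fst pq) (snd pq) < 1 / (real n + 1) \<and>
        e \<le> (\<integral>x. \<bar>D (fst pq) x - D (snd pq) x\<bar> \<partial>M)"
      by simp
    from choice[OF this] obtain pq where pq: "\<And>n. fst (pq n) \<in> Q" "\<And>n. snd (pq n) \<in> Q"
      "\<And>n. d (fst (pq n)) (snd (pq n)) < 1 / (real n + 1)"
      "\<And>n. e \<le> (\<integral>x. \<bar>D (fst (pq n)) x - D (snd (pq n)) x\<bar> \<partial>M)"
      by blast
    have "(\<lambda>n. \<integral>x. \<bar>D (fst (pq n)) x - D (snd (pq n)) x\<bar> \<partial>M) \<longlonglongrightarrow> (\<integral>x. 0 \<partial>M)"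
    proof (rule integral_dominated_convergence)
      show "integrable M (\<lambda>x. 2 * h x)" using dom(1) by simp
      show "(\<lambda>x. \<bar>D (fst (pq n)) x - D (snd (pq n)) x\<bar>) \<in> borel_measurable M" for n
        using int[OF pq(1)[of n]] int[OF pq(2)[of n]] by auto
      show "AE x in M. norm \<bar>D (fst (pq n)) x - D (snd (pq n)) x\<bar> \<le> 2 * h x" for n
        using dom(2)
      proof eventually_elim
        case (elim x)
        then have "\<bar>D (fst (pq n)) x\<bar> \<le> h x" "\<bar>D (snd (pq n)) x\<bar> \<le> h x" using pq(1,2) by auto
        then show ?case by simp
      qed
      show "AE x in M. (\<lambda>n. \<bar>D (fst (pq n)) x - D (snd (pq n)) x\<bar>) \<longlonglongrightarrow> 0"
        using uc
      proof eventually_elim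
        case (elim x)
        show ?case
        proof (rule LIMSEQ_I)
          fix r :: real assume "0 < r"
          then obtain \<delta> where \<delta>: "0 < \<delta>" "\<forall>p\<in>Q. \<forall>q\<in>Q. d p q < \<delta> \<longrightarrow> \<bar>D p x - D q x\<bar> < r"
            using elim by blast
          obtain N :: nat where N: "1 / \<delta> < real N" using reals_Archimedean2 by blast
          have "norm (\<bar>D (fst (pq n)) x - D (snd (pq n)) x\<bar> - 0) < r" if "N \<le> n" for n
          proof -
            have "1 / \<delta> < real n + 1" using N that by linarith
            then have "1 / (real n + 1) < \<delta>" using \<delta>(1) by (simp add: field_simps)
            then have "d (fst (pq n)) (snd (pq n)) < \<delta>" using pq(3)[of n] by linarith
            then show ?thesis using \<delta>(2) pq(1,2) by simp
          qed
          then show "\<exists>N. \<forall>n\<ge>N. norm (\<bar>D (fst (pq n)) x - D (snd (pq n)) x\<bar> - 0) < r" by blast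
        qed
      qed
    qed simp
    then have "e \<le> (\<integral>x. 0 \<partial>M)" using pq(4) by (intro LIMSEQ_le_const) auto
    then show False using e by simp
  qed
  then obtain \<delta> where \<delta>: "0 < \<delta>" "\<forall>p\<in>Q. \<forall>q\<in>Q. d p q < \<delta> \<longrightarrow> (\<integral>x. \<bar>D p x - D q x\<bar> \<partial>M) < e"
    by blast
  obtain K where K: "finite K" "K \<subseteq> Q" "Q \<subseteq> (\<Union>k\<in>K. {q\<in>Q. d k q < \<delta>})"
    using tb[rule_format, OF \<delta>(1)] by (elim exE conjE)
  have "\<exists>k\<in>K. (\<integral>x. \<bar>D q x - D k x\<bar> \<partial>M) < e" if q: "q \<in> Q" for q
  proof -
    obtain k where k: "k \<in> K" "d k q < \<delta>" using K(3) q by blast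
    then have "(\<integral>x. \<bar>D k x - D q x\<bar> \<partial>M) < e" using \<delta>(2) K(2) q by blast
    then show ?thesis using k(1) by (auto simp: abs_minus_commute)
  qed
  moreover have "K \<noteq> {}" using K(3) ne by auto
  ultimately show ?thesis using K by blast
qed

section \<open>Stopping times\<close>

locale filtered_prob_space = prob_space M
  for M :: "'a measure" +
  fixes F :: "real \<Rightarrow> 'a measure" and T :: real
  assumes T_pos: "0 < T"
    and F_sub: "\<forall>t\<in>{0..T}. subalgebra M (F t)"
    and F_mono: "\<forall>s t. 0 \<le> s \<and> s \<le> t \<and> t \<le> T \<longrightarrow> sets (F s) \<subseteq> sets (F t)"
begin

abbreviation stopping :: "('a \<Rightarrow> real) \<Rightarrow> bool" where
  "stopping \<equiv> is_stopping_time M F T"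

lemma sets_F: "0 \<le> t \<Longrightarrow> t \<le> T \<Longrightarrow> A \<in> sets (F t) \<Longrightarrow> A \<in> sets M"
  and space_F: "0 \<le> t \<Longrightarrow> t \<le> T \<Longrightarrow> space (F t) = space M"
  using F_sub by (auto simp: subalgebra_def)

lemma stoppingD:
  assumes "stopping \<tau>" "\<omega> \<in> space M"
  shows "0 \<le> \<tau> \<omega>" "\<tau> \<omega> \<le> T"
  using assms by (auto simp: is_stopping_time_def)

lemma stopping_measurable:
  assumes "stopping \<tau>"
  shows "\<tau> \<in> borel_measurable M"
proof (rule borel_measurableI_le)
  fix t
  consider "t < 0" | "0 \<le> t" "t \<le> T" | "T < t" by linarith
  then show "{\<omega>\<in>space M. \<tau> \<omega> \<le> t} \<in> sets M"
  proof cases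
    case 1
    then have "{\<omega>\<in>space M. \<tau> \<omega> \<le> t} = {}" using stoppingD(1)[OF assms] by force
    then show ?thesis by (simp only: sets.empty_sets)
  next
    case 2
    then have "{\<omega>\<in>space M. \<tau> \<omega> \<le> t} \<in> sets (F t)"
      using assms by (simp add: is_stopping_time_def)
    then show ?thesis by (rule sets_F[OF 2])
  next
    case 3
    then have "{\<omega>\<in>space M. \<tau> \<omega> \<le> t} = space M" using stoppingD(2)[OF assms] by force
    then show ?thesis by (simp only: sets.top)
  qed
qed

lemma stopping_max:
  assumes "stopping \<tau>" "0 \<le> t" "t \<le> T"
  shows "stopping (\<lambda>\<omega>. max (\<tau> \<omega>) t)"
  unfolding is_stopping_time_def
proof (intro conjI ballI)
  fix s assume s: "s \<in> {0..T}"
  show "{\<omega>\<in>space M. max (\<tau> \<omega>) t \<le> s} \<in> sets (F s)"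
  proof (cases "t \<le> s")
    case True
    then show ?thesis using assms s by (simp add: is_stopping_time_def)
  qed simp
qed (use assms stoppingD in \<open>auto simp: max_def\<close>)

text \<open>Neither time has occurred before \<open>t\<close>, so for \<open>s < t\<close> the event
  to be tested is empty; for \<open>s \<ge> t\<close> the set \<open>A\<close> already belongs to
  \<open>F s\<close>.\<close>

lemma stopping_paste:
  assumes \<tau>: "stopping \<tau>" "\<And>\<omega>. \<omega> \<in> space M \<Longrightarrow> t \<le> \<tau> \<omega>"
    and \<sigma>: "stopping \<sigma>" "\<And>\<omega>. \<omega> \<in> space M \<Longrightarrow> t \<le> \<sigma> \<omega>"
    and A: "A \<in> sets (F t)" and t: "0 \<le> t" "t \<le> T"
  shows "stopping (\<lambda>\<omega>. if \<omega> \<in> A then \<tau> \<omega> else \<sigma> \<omega>)"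
  unfolding is_stopping_time_def
proof (intro conjI ballI)
  fix s assume s: "s \<in> {0..T}"
  show "{\<omega>\<in>space M. (if \<omega> \<in> A then \<tau> \<omega> else \<sigma> \<omega>) \<le> s} \<in> sets (F s)" (is "?S \<in> _")
  proof (cases "t \<le> s")
    case True
    then have "A \<in> sets (F s)" using F_mono t s A by (meson atLeastAtMost_iff subsetD)
    moreover have "{\<omega>\<in>space M. \<tau> \<omega> \<le> s} \<in> sets (F s)" "{\<omega>\<in>space M. \<sigma> \<omega> \<le> s} \<in> sets (F s)"
      using \<tau>(1) \<sigma>(1) s by (auto simp: is_stopping_time_def)
    moreover have "?S = (A \<inter> {\<omega>\<in>space M. \<tau> \<omega> \<le> s}) \<union> ({\<omega>\<in>space M. \<sigma> \<omega> \<le> s} - A)"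
      by auto
    ultimately show ?thesis by (simp only: sets.Un sets.Int sets.Diff)
  next
    case False
    then have "?S = {}" using \<tau>(2) \<sigma>(2) by force
    then show ?thesis by (simp only: sets.empty_sets)
  qed
qed (use \<tau> \<sigma> stoppingD in auto)

lemma stopping_zero: "stopping (\<lambda>_. 0)"
proof -
  have "space M \<in> sets (F t)" if "0 \<le> t" "t \<le> T" for t
    using sets.top[of "F t"] space_F[OF that] by simp
  then show ?thesis using T_pos by (auto simp: is_stopping_time_def)
qed

end

section \<open>Right-continuous processes at stopping times\<close>

locale adapted_process = filtered_prob_space M F T
  for M :: "'a measure" and F T +
  fixes Y :: "real \<Rightarrow> 'a \<Rightarrow> real"
  assumes Y_adapted: "\<forall>t\<in>{0..T}. Y t \<in> borel_measurable (F t)"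
    and Y_rcont: "\<forall>\<omega>\<in>space M. \<forall>t\<in>{0..<T}. ((\<lambda>s. Y s \<omega>) \<longlongrightarrow> Y t \<omega>) (at_right t)"
    and Y_bdd: "\<forall>\<omega>\<in>space M. bounded ((\<lambda>t. Y t \<omega>) ` {0..T})"
begin

definition Ystar :: "'a \<Rightarrow> real" where
  "Ystar \<omega> = (SUP t\<in>{0..T}. \<bar>Y t \<omega>\<bar>)"

lemma Y_tendsto_right:
  assumes "\<omega> \<in> space M" "0 \<le> t" "t < T" "\<And>n. t < s n" "s \<longlonglongrightarrow> t"
  shows "(\<lambda>n. Y (s n) \<omega>) \<longlonglongrightarrow> Y t \<omega>"
proof -
  have "((\<lambda>s. Y s \<omega>) \<longlongrightarrow> Y t \<omega>) (at_right t)" using Y_rcont assms(1-3) by simp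
  moreover have "filterlim s (at_right t) sequentially"
    using assms(4,5) by (auto simp: filterlim_at intro!: always_eventually)
  ultimately show ?thesis by (rule filterlim_compose)
qed

text \<open>Approximation from the right: at a time with values in a countable grid the process is a
  countable composition of measurable variables, and right-continuity passes measurability to the
  limit.\<close>

lemma stopped_measurable:
  assumes \<tau>: "stopping \<tau>"
  shows "(\<lambda>\<omega>. Y (\<tau> \<omega>) \<omega>) \<in> borel_measurable M"
proof -
  \<comment> \<open>The added \<open>1\<close> places the grid value strictly above
    \<open>\<tau>\<close>, as a limit from the right requires. The cut-offs at \<open>0\<close> and
    \<open>T\<close> put every integer index, even one that the floor never takes, into the range
    where \<open>Y\<close> is adapted.\<close>
  define r where "r n i = max 0 (min T ((real_of_int i + 1) / (real n + 1)))" for n i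
  define \<sigma> where "\<sigma> n \<omega> = r n \<lfloor>\<tau> \<omega> * (real n + 1)\<rfloor>" for n \<omega>
  have meas: "(\<lambda>\<omega>. Y (\<sigma> n \<omega>) \<omega>) \<in> borel_measurable M" for n
    unfolding \<sigma>_def
  proof (rule measurable_compose_countable[where f="\<lambda>i \<omega>. Y (r n i) \<omega>"])
    fix i
    have "0 \<le> r n i" "r n i \<le> T" using T_pos by (auto simp: r_def)
    then show "Y (r n i) \<in> borel_measurable M"
      using Y_adapted F_sub by (intro measurable_from_subalg[of M "F (r n i)"]) auto
  next
    show "(\<lambda>\<omega>. \<lfloor>\<tau> \<omega> * (real n + 1)\<rfloor>) \<in> measurable M (count_space UNIV)"
      using stopping_measurable[OF \<tau>] by measurable
  qed
  show ?thesis
  proof (rule borel_measurable_LIMSEQ_real[OF _ meas])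
    fix \<omega> assume \<omega>: "\<omega> \<in> space M"
    let ?t = "\<tau> \<omega>"
    have t: "0 \<le> ?t" "?t \<le> T" using stoppingD[OF \<tau> \<omega>] by auto
    have low: "?t < (real_of_int \<lfloor>?t * (real n + 1)\<rfloor> + 1) / (real n + 1)" for n
      using floor_correct[of "?t * (real n + 1)"] by (subst pos_less_divide_eq) auto
    have up: "(real_of_int \<lfloor>?t * (real n + 1)\<rfloor> + 1) / (real n + 1) \<le> ?t + 1 / (real n + 1)" for n
    proof -
      have "(real_of_int \<lfloor>?t * (real n + 1)\<rfloor> + 1) / (real n + 1) \<le> (?t * (real n + 1) + 1) / (real n + 1)"
        by (intro divide_right_mono) auto
      also have "\<dots> = ?t + 1 / (real n + 1)" by (simp add: add_divide_distrib)
      finally show ?thesis .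
    qed
    show "(\<lambda>n. Y (\<sigma> n \<omega>) \<omega>) \<longlonglongrightarrow> Y ?t \<omega>"
    proof (cases "?t = T")
      case True
      \<comment> \<open>At \<open>T\<close> there is no time to the right; the cut-off makes the
        approximation constant.\<close>
      then have "\<sigma> n \<omega> = T" for n
        unfolding \<sigma>_def r_def using low[of n] T_pos by simp
      then show ?thesis using True by simp
    next
      case False
      show ?thesis
      proof (rule Y_tendsto_right[OF \<omega> t(1)])
        show tT: "?t < T" using False t by simp
        show gr: "?t < \<sigma> n \<omega>" for n
          unfolding \<sigma>_def r_def using low[of n] t tT by auto
        have up': "\<sigma> n \<omega> \<le> ?t + 1 / (real n + 1)" for n
          using up[of n] t unfolding \<sigma>_def r_def by auto
        have lim: "(\<lambda>n. ?t + 1 / (real n + 1)) \<longlonglongrightarrow> ?t"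
          using tendsto_add[OF tendsto_const LIMSEQ_inverse_real_of_nat, of ?t]
          by (simp add: inverse_eq_divide add.commute)
        show "(\<lambda>n. \<sigma> n \<omega>) \<longlonglongrightarrow> ?t"
          by (rule tendsto_sandwich[OF _ _ tendsto_const lim])
            (simp_all add: less_imp_le[OF gr] up')
      qed
    qed
  qed
qed

lemma abs_le_Ystar:
  assumes "\<omega> \<in> space M" "0 \<le> t" "t \<le> T"
  shows "\<bar>Y t \<omega>\<bar> \<le> Ystar \<omega>"
  unfolding Ystar_def
proof (rule cSUP_upper)
  obtain a where "\<forall>x\<in>(\<lambda>t. Y t \<omega>) ` {0..T}. norm x \<le> a"
    using Y_bdd assms(1) unfolding bounded_iff by blast
  then show "bdd_above ((\<lambda>t. \<bar>Y t \<omega>\<bar>) ` {0..T})" by (intro bdd_aboveI[of _ a]) auto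
qed (use assms in auto)

lemma Ystar_nonneg: "\<omega> \<in> space M \<Longrightarrow> 0 \<le> Ystar \<omega>"
  using abs_le_Ystar[of \<omega> 0] T_pos by simp

lemma stopped_le_Ystar: "stopping \<tau> \<Longrightarrow> \<omega> \<in> space M \<Longrightarrow> \<bar>Y (\<tau> \<omega>) \<omega>\<bar> \<le> Ystar \<omega>"
  using stoppingD abs_le_Ystar by simp

lemma stopped_integrable:
  assumes "sets q = sets M" "integrable q Ystar" "stopping \<tau>"
  shows "integrable q (\<lambda>\<omega>. Y (\<tau> \<omega>) \<omega>)"
proof (rule Bochner_Integration.integrable_bound[OF assms(2)])
  show "(\<lambda>\<omega>. Y (\<tau> \<omega>) \<omega>) \<in> borel_measurable q"
    using stopped_measurable[OF assms(3)] measurable_cong_sets[OF assms(1) refl] by blast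
  show "AE \<omega> in q. norm (Y (\<tau> \<omega>) \<omega>) \<le> norm (Ystar \<omega>)"
    using stopped_le_Ystar[OF assms(3)] Ystar_nonneg sets_eq_imp_space_eq[OF assms(1)]
    by (intro AE_I2) simp
qed

text \<open>Right-continuity is invoked only where \<open>\<tau>\<close> vanishes: where
  \<open>\<tau>\<close> is positive, the maximum eventually equals \<open>\<tau>\<close>.
  \<open>Ystar\<close> dominates all the rewards.\<close>

lemma stopped_max_tendsto:
  assumes q: "sets q = sets M" "integrable q Ystar" and \<tau>: "stopping \<tau>"
  shows "(\<lambda>n. \<integral>\<omega>. Y (max (\<tau> \<omega>) (T / (real n + 2))) \<omega> \<partial>q) \<longlonglongrightarrow> (\<integral>\<omega>. Y (\<tau> \<omega>) \<omega> \<partial>q)"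
proof (rule integral_dominated_convergence[OF _ _ q(2)])
  have sp: "space q = space M" using q(1) by (rule sets_eq_imp_space_eq)
  have st: "stopping (\<lambda>\<omega>. max (\<tau> \<omega>) (T / (real n + 2)))" for n
    using T_pos by (intro stopping_max[OF \<tau>]) (auto simp: field_simps)
  show "(\<lambda>\<omega>. Y (\<tau> \<omega>) \<omega>) \<in> borel_measurable q"
    using stopped_integrable[OF q \<tau>] by auto
  show "(\<lambda>\<omega>. Y (max (\<tau> \<omega>) (T / (real n + 2))) \<omega>) \<in> borel_measurable q" for n
    using stopped_integrable[OF q st[of n]] by auto
  show "AE \<omega> in q. norm (Y (max (\<tau> \<omega>) (T / (real n + 2))) \<omega>) \<le> Ystar \<omega>" for n
    using stopped_le_Ystar[OF st[of n]] sp by (intro AE_I2) simp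
  have lim: "(\<lambda>n. T / (real n + 2)) \<longlonglongrightarrow> 0"
    using tendsto_mult_right_zero[OF LIMSEQ_Suc[OF LIMSEQ_inverse_real_of_nat], of T]
    by (simp add: field_simps)
  show "AE \<omega> in q. (\<lambda>n. Y (max (\<tau> \<omega>) (T / (real n + 2))) \<omega>) \<longlonglongrightarrow> Y (\<tau> \<omega>) \<omega>"
  proof (rule AE_I2)
    fix \<omega> assume "\<omega> \<in> space q"
    then have \<omega>: "\<omega> \<in> space M" using sp by simp
    show "(\<lambda>n. Y (max (\<tau> \<omega>) (T / (real n + 2))) \<omega>) \<longlonglongrightarrow> Y (\<tau> \<omega>) \<omega>"
    proof (cases "\<tau> \<omega> = 0")
      case True
      have "max (\<tau> \<omega>) (T / (real n + 2)) = T / (real n + 2)" for n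
        using True T_pos by simp
      then show ?thesis
        using True T_pos lim by (simp add: Y_tendsto_right[OF \<omega>])
    next
      case False
      then have "0 < \<tau> \<omega>" using stoppingD[OF \<tau> \<omega>] by simp
      then have "\<forall>\<^sub>F n in sequentially. T / (real n + 2) < \<tau> \<omega>"
        by (rule order_tendstoD(2)[OF lim])
      then have "\<forall>\<^sub>F n in sequentially. Y (max (\<tau> \<omega>) (T / (real n + 2))) \<omega> = Y (\<tau> \<omega>) \<omega>"
        by eventually_elim simp
      then show ?thesis by (rule tendsto_eventually)
    qed
  qed
qed

text \<open>Pasting \<open>u'\<close> on \<open>A\<close> and \<open>v'\<close> off \<open>A\<close>
  earns the reward of \<open>v'\<close> plus the integral of \<open>f k\<close> over
  \<open>A\<close>. The reward is thus affine in the indicator of \<open>A\<close>, and a set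
  capturing about the fraction \<open>l\<close> of the integral of every \<open>f k\<close> realises
  the convex combination. Half of \<open>e\<close> pays for this set, the other half for the
  delay.\<close>

lemma stopped_approx_convex:
  assumes atomless: "\<forall>t\<in>{0<..T}. atomless_measure (restr_to_subalg M (F t))"
    and K: "finite K" "\<And>k. k \<in> K \<Longrightarrow> integrable k Ystar"
    and D: "\<And>k. k \<in> K \<Longrightarrow> D k \<in> borel_measurable M" "\<And>k. k \<in> K \<Longrightarrow> \<forall>\<omega>\<in>space M. 0 \<le> D k \<omega>"
      "\<And>k. k \<in> K \<Longrightarrow> k = density M (\<lambda>\<omega>. ennreal (D k \<omega>))"
    and st: "stopping u" "stopping v" and l: "0 \<le> l" "l \<le> 1" and e: "0 < e"
  shows "\<exists>\<tau>. stopping \<tau> \<and> (\<forall>k\<in>K. \<bar>(\<integral>\<omega>. Y (\<tau> \<omega>) \<omega> \<partial>k)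
      - (l * (\<integral>\<omega>. Y (u \<omega>) \<omega> \<partial>k) + (1 - l) * (\<integral>\<omega>. Y (v \<omega>) \<omega> \<partial>k))\<bar> < e)"
proof -
  let ?E = "\<lambda>k \<tau>. \<integral>\<omega>. Y (\<tau> \<omega>) \<omega> \<partial>k"
  have sK: "sets k = sets M" if "k \<in> K" for k using D(3)[OF that] by (metis sets_density)
  have "\<forall>\<^sub>F n in sequentially. \<forall>k\<in>K.
      \<bar>?E k (\<lambda>\<omega>. max (\<tau> \<omega>) (T / (real n + 2))) - ?E k \<tau>\<bar> < e / 2" if "stopping \<tau>" for \<tau>
  proof (intro eventually_ball_finite ballI K(1))
    fix k assume "k \<in> K"
    then show "\<forall>\<^sub>F n in sequentially. \<bar>?E k (\<lambda>\<omega>. max (\<tau> \<omega>) (T / (real n + 2))) - ?E k \<tau>\<bar> < e / 2"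
      using tendstoD[OF stopped_max_tendsto[OF sK K(2) that], of k "e / 2"] e
      by (simp add: dist_real_def)
  qed
  \<comment> \<open>Because \<open>K\<close> is finite, one delay serves all its measures and both
    stopping times.\<close>
  from eventually_conj[OF this[OF st(1)] this[OF st(2)]]
  obtain n where n: "\<forall>k\<in>K. \<bar>?E k (\<lambda>\<omega>. max (u \<omega>) (T / (real n + 2))) - ?E k u\<bar> < e / 2"
    "\<forall>k\<in>K. \<bar>?E k (\<lambda>\<omega>. max (v \<omega>) (T / (real n + 2))) - ?E k v\<bar> < e / 2"
    by (auto simp: eventually_sequentially)
  define t where "t = T / (real n + 2)"
  have t: "0 < t" "t \<le> T" using T_pos by (auto simp: t_def field_simps)
  define u' where "u' \<omega> = max (u \<omega>) t" for \<omega>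
  define v' where "v' \<omega> = max (v \<omega>) t" for \<omega>
  have st': "stopping u'" "stopping v'"
    unfolding u'_def v'_def using stopping_max st t by simp_all
  define f where "f k \<omega> = D k \<omega> * (Y (u' \<omega>) \<omega> - Y (v' \<omega>) \<omega>)" for k \<omega>
  have int: "integrable M (\<lambda>\<omega>. D k \<omega> * Y (\<tau> \<omega>) \<omega>)" if "k \<in> K" "stopping \<tau>" for k \<tau>
    using stopped_integrable[OF sK K(2) that(2)] that(1)
    by (subst integrable_wrt_density[symmetric, OF D(3,1,2) stopped_measurable]) (use that in auto)
  have intf: "integrable M (f k)" if "k \<in> K" for k
    unfolding f_def using int[OF that st'(1)] int[OF that st'(2)] by (simp add: right_diff_distrib)
  obtain A where A: "A \<in> sets (F t)"
    "\<forall>k\<in>K. \<bar>(\<integral>\<omega>. indicator A \<omega> * f k \<omega> \<partial>M) - l * (\<integral>\<omega>. f k \<omega> \<partial>M)\<bar> < e / 2"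
    using atomless_subalg_approx_convexity[of M "F t" K f l "e / 2"] F_sub atomless t K(1) intf l e
      finite_measure_axioms by auto
  define \<tau> where "\<tau> \<omega> = (if \<omega> \<in> A then u' \<omega> else v' \<omega>)" for \<omega>
  have \<tau>: "stopping \<tau>"
    unfolding \<tau>_def by (rule stopping_paste[OF st'(1) _ st'(2) _ A(1)])
      (use t in \<open>auto simp: u'_def v'_def\<close>)
  have "\<bar>?E k \<tau> - (l * ?E k u + (1 - l) * ?E k v)\<bar> < e" if k: "k \<in> K" for k
  proof -
    have E: "?E k \<sigma> = (\<integral>\<omega>. D k \<omega> * Y (\<sigma> \<omega>) \<omega> \<partial>M)" if "stopping \<sigma>" for \<sigma>
      by (rule integral_wrt_density[OF D(3,1,2) stopped_measurable[OF that]]) (use k in auto)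
    have AM: "A \<in> sets M" using sets_F[OF _ t(2) A(1)] t(1) by simp
    have "?E k \<tau> = (\<integral>\<omega>. D k \<omega> * Y (v' \<omega>) \<omega> + indicator A \<omega> * f k \<omega> \<partial>M)"
      unfolding E[OF \<tau>] by (intro Bochner_Integration.integral_cong)
        (auto simp: \<tau>_def f_def indicator_def algebra_simps)
    also have "\<dots> = ?E k v' + (\<integral>\<omega>. indicator A \<omega> * f k \<omega> \<partial>M)"
      unfolding E[OF st'(2)] using int[OF k st'(2)] integrable_mult_indicator[OF AM intf[OF k]]
      by (intro Bochner_Integration.integral_add) auto
    finally have 1: "?E k \<tau> = ?E k v' + (\<integral>\<omega>. indicator A \<omega> * f k \<omega> \<partial>M)" .
    have f: "(\<integral>\<omega>. f k \<omega> \<partial>M) = ?E k u' - ?E k v'"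
      unfolding E[OF st'(1)] E[OF st'(2)] f_def right_diff_distrib
      using int[OF k st'(1)] int[OF k st'(2)] by (rule Bochner_Integration.integral_diff)
    have "?E k \<tau> - (l * ?E k u' + (1 - l) * ?E k v')
        = (\<integral>\<omega>. indicator A \<omega> * f k \<omega> \<partial>M) - l * (\<integral>\<omega>. f k \<omega> \<partial>M)"
      unfolding 1 f by (simp add: algebra_simps)
    then have 2: "\<bar>?E k \<tau> - (l * ?E k u' + (1 - l) * ?E k v')\<bar> < e / 2"
      using A(2) k by simp
    have "\<bar>?E k u' - ?E k u\<bar> \<le> e / 2" "\<bar>?E k v' - ?E k v\<bar> \<le> e / 2"
      unfolding u'_def v'_def t_def using n k by (auto intro: less_imp_le)
    then have "l * \<bar>?E k u' - ?E k u\<bar> \<le> l * (e / 2)" "(1 - l) * \<bar>?E k v' - ?E k v\<bar> \<le> (1 - l) * (e / 2)"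
      using l by (simp_all only: mult_left_mono diff_ge_0_iff_ge)
    then have "\<bar>l * (?E k u' - ?E k u)\<bar> \<le> l * (e / 2)" "\<bar>(1 - l) * (?E k v' - ?E k v)\<bar> \<le> (1 - l) * (e / 2)"
      using l by (auto simp: abs_mult)
    moreover have "l * (e / 2) + (1 - l) * (e / 2) = e / 2" by (simp add: field_simps)
    moreover have "?E k \<tau> - (l * ?E k u + (1 - l) * ?E k v) = (?E k \<tau> - (l * ?E k u' + (1 - l) * ?E k v'))
        + l * (?E k u' - ?E k u) + (1 - l) * (?E k v' - ?E k v)"
      by (simp add: algebra_simps)
    ultimately show ?thesis using 2 by linarith
  qed
  then show ?thesis using \<tau> by blast
qed

end

section \<open>Convex combinations of measures with densities\<close>

lemma emeasure_wrt_density: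
  fixes g :: "'a \<Rightarrow> real"
  assumes "q = density M (\<lambda>x. ennreal (g x))" "g \<in> borel_measurable M" "A \<in> sets M"
  shows "emeasure q A = (\<integral>\<^sup>+x. ennreal (g x) * indicator A x \<partial>M)"
  using assms(2,3) unfolding assms(1) by (simp add: emeasure_density)

lemma
  fixes D :: "'a measure \<Rightarrow> 'a \<Rightarrow> real"
  assumes w: "\<And>q. q \<in> I \<Longrightarrow> 0 \<le> w q"
    and D: "\<And>q. q \<in> I \<Longrightarrow> D q \<in> borel_measurable M" "\<And>q. q \<in> I \<Longrightarrow> \<forall>x\<in>space M. 0 \<le> D q x"
      "\<And>q. q \<in> I \<Longrightarrow> q = density M (\<lambda>x. ennreal (D q x))"
  shows emeasure_mixture: "A \<in> sets M \<Longrightarrow>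
      emeasure (density M (\<lambda>x. ennreal (\<Sum>q\<in>I. w q * D q x))) A = (\<Sum>q\<in>I. ennreal (w q) * emeasure q A)"
    and integral_mixture: "f \<in> borel_measurable M \<Longrightarrow> (\<And>q. q \<in> I \<Longrightarrow> integrable q f) \<Longrightarrow>
      (\<integral>x. f x \<partial>density M (\<lambda>x. ennreal (\<Sum>q\<in>I. w q * D q x))) = (\<Sum>q\<in>I. w q * (\<integral>x. f x \<partial>q))"
proof -
  have meas: "(\<lambda>x. \<Sum>q\<in>I. w q * D q x) \<in> borel_measurable M"
    using D(1) by (intro borel_measurable_sum borel_measurable_times) auto
  have nn: "\<forall>x\<in>space M. 0 \<le> (\<Sum>q\<in>I. w q * D q x)"
    using w D(2) by (auto intro!: sum_nonneg)
  {
    assume A: "A \<in> sets M"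
    have "emeasure (density M (\<lambda>x. ennreal (\<Sum>q\<in>I. w q * D q x))) A
        = (\<integral>\<^sup>+x. (\<Sum>q\<in>I. ennreal (w q) * (ennreal (D q x) * indicator A x)) \<partial>M)"
      unfolding emeasure_wrt_density[OF refl meas A]
    proof (rule nn_integral_cong)
      fix x assume "x \<in> space M"
      then have "ennreal (\<Sum>q\<in>I. w q * D q x) = (\<Sum>q\<in>I. ennreal (w q) * ennreal (D q x))"
        using w D(2) by (subst sum_ennreal[symmetric]) (auto simp: ennreal_mult intro!: sum.cong)
      then show "ennreal (\<Sum>q\<in>I. w q * D q x) * indicator A x
          = (\<Sum>q\<in>I. ennreal (w q) * (ennreal (D q x) * indicator A x))"
        by (simp add: sum_distrib_right mult.assoc)
    qed
    also have "\<dots> = (\<Sum>q\<in>I. ennreal (w q) * (\<integral>\<^sup>+x. ennreal (D q x) * indicator A x \<partial>M))"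
      using D(1) A by (subst nn_integral_sum) (auto intro!: sum.cong nn_integral_cmult)
    also have "\<dots> = (\<Sum>q\<in>I. ennreal (w q) * emeasure q A)"
      using emeasure_wrt_density[OF D(3,1) A] by (auto intro!: sum.cong)
    finally show "emeasure (density M (\<lambda>x. ennreal (\<Sum>q\<in>I. w q * D q x))) A
      = (\<Sum>q\<in>I. ennreal (w q) * emeasure q A)" .
  }
  {
    assume f: "f \<in> borel_measurable M" and int: "\<And>q. q \<in> I \<Longrightarrow> integrable q f"
    have i: "integrable M (\<lambda>x. D q x * f x)" if "q \<in> I" for q
      using int[OF that] integrable_wrt_density[OF D(3,1,2) f] that by blast
    have "(\<integral>x. f x \<partial>density M (\<lambda>x. ennreal (\<Sum>q\<in>I. w q * D q x)))
        = (\<integral>x. (\<Sum>q\<in>I. w q * (D q x * f x)) \<partial>M)"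
      unfolding integral_wrt_density[OF refl meas nn f] by (simp add: sum_distrib_right mult.assoc)
    also have "\<dots> = (\<Sum>q\<in>I. w q * (\<integral>x. D q x * f x \<partial>M))"
      using i by (subst Bochner_Integration.integral_sum) auto
    also have "\<dots> = (\<Sum>q\<in>I. w q * (\<integral>x. f x \<partial>q))"
      using integral_wrt_density[OF D(3,1,2) f] by (auto intro!: sum.cong)
    finally show "(\<integral>x. f x \<partial>density M (\<lambda>x. ennreal (\<Sum>q\<in>I. w q * D q x))) = (\<Sum>q\<in>I. w q * (\<integral>x. f x \<partial>q))" .
  }
qed

text \<open>An element of the hull is known only through its values on sets; these identify it with
  the measure of the mixed density, after which expectations split. The weights are fixed before
  \<open>f\<close>, so that one decomposition serves all stopping times.\<close>

lemma co_measures_integral: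
  fixes D :: "'a measure \<Rightarrow> 'a \<Rightarrow> real"
  assumes D: "\<And>q. q \<in> Q \<Longrightarrow> D q \<in> borel_measurable M" "\<And>q. q \<in> Q \<Longrightarrow> \<forall>x\<in>space M. 0 \<le> D q x"
      "\<And>q. q \<in> Q \<Longrightarrow> q = density M (\<lambda>x. ennreal (D q x))"
    and N: "N \<in> co_measures M Q"
  obtains I w where "finite I" "I \<subseteq> Q" "\<And>q. q \<in> I \<Longrightarrow> 0 \<le> w q" "sum w I = 1"
    "\<And>f :: 'a \<Rightarrow> real. f \<in> borel_measurable M \<Longrightarrow> (\<And>q. q \<in> Q \<Longrightarrow> integrable q f) \<Longrightarrow>
      (\<integral>x. f x \<partial>N) = (\<Sum>q\<in>I. w q * (\<integral>x. f x \<partial>q))"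
proof -
  obtain I w where I: "finite I" "I \<subseteq> Q" "\<forall>q\<in>I. 0 \<le> w q" "sum w I = 1"
    "\<forall>A\<in>sets M. emeasure N A = (\<Sum>q\<in>I. ennreal (w q) * emeasure q A)" and s: "sets N = sets M"
    using N unfolding co_measures_def by blast
  have "N = density M (\<lambda>x. ennreal (\<Sum>q\<in>I. w q * D q x))"
  proof (rule measure_eqI)
    fix A assume "A \<in> sets N"
    then have A: "A \<in> sets M" using s by simp
    have "emeasure (density M (\<lambda>x. ennreal (\<Sum>q\<in>I. w q * D q x))) A = (\<Sum>q\<in>I. ennreal (w q) * emeasure q A)"
      by (rule emeasure_mixture[OF _ D A]) (use I in auto)
    then show "emeasure N A = emeasure (density M (\<lambda>x. ennreal (\<Sum>q\<in>I. w q * D q x))) A"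
      using I(5) A by simp
  qed (use s in simp)
  then have "(\<integral>x. f x \<partial>N) = (\<Sum>q\<in>I. w q * (\<integral>x. f x \<partial>q))"
    if "f \<in> borel_measurable M" "\<And>q. q \<in> Q \<Longrightarrow> integrable q f" for f :: "'a \<Rightarrow> real"
    by (simp only:) (rule integral_mixture[OF _ D that(1)], use I that in auto)
  then show ?thesis using that[of I w] I by blast
qed

section \<open>The minimax equality\<close>

context adapted_process
begin

text \<open>Discarding the event \<open>Ystar > a\<close> costs less than \<open>e / 4\<close> under
  every measure of \<open>Q\<close>. The remaining reward is bounded by \<open>a\<close>, so a mean
  distance of densities below \<open>e / (4 * a)\<close> contributes less than another
  \<open>e / 4\<close>. Neither bound involves the stopping time, hence one net works for all of
  them.\<close>

lemma finite_net:
  fixes D :: "'a measure \<Rightarrow> 'a \<Rightarrow> real" and d :: "'a measure \<Rightarrow> 'a measure \<Rightarrow> real"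
  assumes Q_ne: "Q \<noteq> {}" and prob: "\<And>q. q \<in> Q \<Longrightarrow> prob_space q"
    and D: "\<And>q. q \<in> Q \<Longrightarrow> D q \<in> borel_measurable M" "\<And>q. q \<in> Q \<Longrightarrow> \<forall>x\<in>space M. 0 \<le> D q x"
      "\<And>q. q \<in> Q \<Longrightarrow> q = density M (\<lambda>x. ennreal (D q x))"
    and tb: "\<forall>e>0. \<exists>K. finite K \<and> K \<subseteq> Q \<and> Q \<subseteq> (\<Union>k\<in>K. {q\<in>Q. d k q < e})"
    and uc: "AE x in M. \<forall>e>0. \<exists>\<delta>>0. \<forall>p\<in>Q. \<forall>q\<in>Q. d p q < \<delta> \<longrightarrow> \<bar>D p x - D q x\<bar> < e"
    and dom: "integrable M h" "AE x in M. \<forall>q\<in>Q. \<bar>D q x\<bar> \<le> h x"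
    and int: "\<And>q. q \<in> Q \<Longrightarrow> integrable q Ystar" "\<And>q. q \<in> Q \<Longrightarrow> (\<integral>\<omega>. Ystar \<omega> \<partial>q) \<le> C"
    and UI: "((\<lambda>a::real. SUP q\<in>Q. \<integral>\<omega>. Ystar \<omega> * indicator {\<omega>. Ystar \<omega> > a} \<omega> \<partial>q) \<longlongrightarrow> 0) at_top"
    and e: "0 < e"
  shows "\<exists>K. finite K \<and> K \<noteq> {} \<and> K \<subseteq> Q \<and> (\<forall>q\<in>Q. \<exists>k\<in>K. \<forall>\<tau>. stopping \<tau> \<longrightarrow>
      \<bar>(\<integral>\<omega>. Y (\<tau> \<omega>) \<omega> \<partial>q) - (\<integral>\<omega>. Y (\<tau> \<omega>) \<omega> \<partial>k)\<bar> < e)"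
proof -
  have sq: "sets q = sets M" "space q = space M" if "q \<in> Q" for q
    using D(3)[OF that] by (metis sets_density, metis space_density)
  \<comment> \<open>\<open>Ystar\<close> is a supremum over uncountably many times; its
    measurability is read off from its integrability under some member of \<open>Q\<close>.\<close>
  have Ym: "Ystar \<in> borel_measurable M"
  proof -
    obtain q where q: "q \<in> Q" using Q_ne by blast
    then show ?thesis using int(1)[OF q] measurable_cong_sets[OF sq(1)[OF q] refl] by blast
  qed
  let ?U = "\<lambda>a q. \<integral>\<omega>. Ystar \<omega> * indicator {\<omega>. Ystar \<omega> > a} \<omega> \<partial>q"
  have tail: "integrable q (\<lambda>\<omega>. Ystar \<omega> * indicator {\<omega>. Ystar \<omega> > a} \<omega>)" if q: "q \<in> Q" for q and a :: real
  proof (rule Bochner_Integration.integrable_bound[OF int(1)[OF q]])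
    have "(\<lambda>\<omega>. Ystar \<omega> * indicator {\<omega>. Ystar \<omega> > a} \<omega>)
        = (\<lambda>\<omega>. Ystar \<omega> * (if a < Ystar \<omega> then 1 else 0))" by (auto simp: indicator_def)
    moreover have "(\<lambda>\<omega>. Ystar \<omega> * (if a < Ystar \<omega> then 1 else 0)) \<in> borel_measurable q"
      using int(1)[OF q] by measurable
    ultimately show "(\<lambda>\<omega>. Ystar \<omega> * indicator {\<omega>. Ystar \<omega> > a} \<omega>) \<in> borel_measurable q" by simp
  qed (auto simp: indicator_def)
  \<comment> \<open>The common bound \<open>C\<close> ensures that the real-valued supremum over
    \<open>Q\<close> dominates each tail integral.\<close>
  have UC: "?U a q \<le> C" if q: "q \<in> Q" for q a
    using Ystar_nonneg sq(2)[OF q]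
    by (intro order_trans[OF integral_mono[OF tail[OF q] int(1)[OF q]] int(2)[OF q]])
      (auto simp: indicator_def)
  have "\<forall>\<^sub>F a in at_top. (SUP q\<in>Q. ?U a q) < e / 4 \<and> 1 \<le> a"
    using order_tendstoD(2)[OF UI, of "e / 4"] e by (intro eventually_conj eventually_ge_at_top) auto
  then obtain a :: real where a: "(SUP q\<in>Q. ?U a q) < e / 4" "1 \<le> a"
    unfolding eventually_at_top_linorder by blast
  have Ua: "?U a q < e / 4" if "q \<in> Q" for q
    using a(1) UC by (intro le_less_trans[OF cSUP_upper[OF that] a(1)] bdd_aboveI[of _ C]) auto
  have Dint: "integrable M (D q)" if q: "q \<in> Q" for q
  proof -
    interpret q: prob_space q by (rule prob[OF q])
    have "integrable q (\<lambda>_. 1 :: real)" by simp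
    then show ?thesis using integrable_wrt_density[OF D(3,1,2), of q "\<lambda>_. 1"] q by simp
  qed
  obtain K where K: "finite K" "K \<noteq> {}" "K \<subseteq> Q"
    "\<forall>q\<in>Q. \<exists>k\<in>K. (\<integral>x. \<bar>D q x - D k x\<bar> \<partial>M) < e / (4 * a)"
    using finite_L1_net[OF Q_ne Dint tb uc dom, of "e / (4 * a)"] e a(2) by auto
  have "\<bar>(\<integral>\<omega>. Y (\<tau> \<omega>) \<omega> \<partial>q) - (\<integral>\<omega>. Y (\<tau> \<omega>) \<omega> \<partial>k)\<bar> < e"
    if q: "q \<in> Q" and k: "k \<in> Q" and L: "(\<integral>x. \<bar>D q x - D k x\<bar> \<partial>M) < e / (4 * a)" and \<tau>: "stopping \<tau>" for q k \<tau>
  proof -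
    define f where "f \<omega> = Y (\<tau> \<omega>) \<omega> * (if a < Ystar \<omega> then 0 else 1)" for \<omega>
    have fm: "f \<in> borel_measurable M"
      unfolding f_def using stopped_measurable[OF \<tau>] Ym by measurable
    have fa: "\<bar>f \<omega>\<bar> \<le> a" if "\<omega> \<in> space M" for \<omega>
      using stopped_le_Ystar[OF \<tau> that] a(2) by (auto simp: f_def)
    have fi: "integrable p f" if p: "p \<in> Q" for p
    proof (rule Bochner_Integration.integrable_bound[OF stopped_integrable[OF sq(1)[OF p] int(1)[OF p] \<tau>]])
      show "f \<in> borel_measurable p" using fm measurable_cong_sets[OF sq(1)[OF p] refl] by blast
    qed (auto simp: f_def)
    have trunc: "\<bar>(\<integral>\<omega>. Y (\<tau> \<omega>) \<omega> \<partial>p) - (\<integral>\<omega>. f \<omega> \<partial>p)\<bar> < e / 4" if p: "p \<in> Q" for p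
    proof -
      have i: "integrable p (\<lambda>\<omega>. Y (\<tau> \<omega>) \<omega>)" by (rule stopped_integrable[OF sq(1)[OF p] int(1)[OF p] \<tau>])
      have "\<bar>(\<integral>\<omega>. Y (\<tau> \<omega>) \<omega> \<partial>p) - (\<integral>\<omega>. f \<omega> \<partial>p)\<bar> = \<bar>\<integral>\<omega>. Y (\<tau> \<omega>) \<omega> - f \<omega> \<partial>p\<bar>"
        using i fi[OF p] by simp
      also have "\<dots> \<le> (\<integral>\<omega>. \<bar>Y (\<tau> \<omega>) \<omega> - f \<omega>\<bar> \<partial>p)" by (rule integral_abs_bound)
      also have "\<dots> \<le> ?U a p"
        using stopped_le_Ystar[OF \<tau>] sq(2)[OF p]
        by (intro integral_mono[OF integrable_abs[OF Bochner_Integration.integrable_diff[OF i fi[OF p]]] tail[OF p]])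
          (auto simp: f_def indicator_def)
      finally show ?thesis using Ua[OF p] by simp
    qed
    have i: "integrable M (\<lambda>x. D p x * f x)" if p: "p \<in> Q" for p
      using fi[OF p] integrable_wrt_density[OF D(3,1,2) fm] p by blast
    have E: "(\<integral>\<omega>. f \<omega> \<partial>p) = (\<integral>x. D p x * f x \<partial>M)" if p: "p \<in> Q" for p
      by (rule integral_wrt_density[OF D(3,1,2) fm]) (use p in auto)
    have "\<bar>(\<integral>\<omega>. f \<omega> \<partial>q) - (\<integral>\<omega>. f \<omega> \<partial>k)\<bar> = \<bar>\<integral>x. D q x * f x - D k x * f x \<partial>M\<bar>"
      unfolding E[OF q] E[OF k] using i[OF q] i[OF k] by simp
    also have "\<dots> \<le> (\<integral>x. \<bar>D q x * f x - D k x * f x\<bar> \<partial>M)" by (rule integral_abs_bound)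
    also have "\<dots> \<le> (\<integral>x. \<bar>D q x - D k x\<bar> * a \<partial>M)"
    proof (rule integral_mono)
      show "integrable M (\<lambda>x. \<bar>D q x * f x - D k x * f x\<bar>)" using i[OF q] i[OF k] by auto
      show "integrable M (\<lambda>x. \<bar>D q x - D k x\<bar> * a)" using Dint[OF q] Dint[OF k] by auto
      fix x assume "x \<in> space M"
      then have "\<bar>D q x - D k x\<bar> * \<bar>f x\<bar> \<le> \<bar>D q x - D k x\<bar> * a"
        using fa by (intro mult_left_mono) auto
      then show "\<bar>D q x * f x - D k x * f x\<bar> \<le> \<bar>D q x - D k x\<bar> * a"
        by (simp only: abs_mult[symmetric] left_diff_distrib)
    qed
    also have "\<dots> = (\<integral>x. \<bar>D q x - D k x\<bar> \<partial>M) * a" by simp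
    also have "\<dots> < e / 4" using L a(2) by (simp add: field_simps)
    finally show ?thesis using trunc[OF q] trunc[OF k] by linarith
  qed
  then show ?thesis using K by (intro exI[of _ K]) blast
qed

text \<open>For a fixed stopping time the expectation is affine in the measure, so passing to the
  hull does not lower the infimum. For the hard inequality of the minimax, the finite version is
  applied at the level \<open>?v + e\<close>, and its weights define a single measure of the hull
  under which no stopping time earns more than that level. The bound \<open>C\<close> keeps all real
  suprema and infima meaningful.\<close>

lemma
  fixes D :: "'a measure \<Rightarrow> 'a \<Rightarrow> real" and d :: "'a measure \<Rightarrow> 'a measure \<Rightarrow> real"
  assumes Q_ne: "Q \<noteq> {}" and prob: "\<And>q. q \<in> Q \<Longrightarrow> prob_space q"
    and D: "\<And>q. q \<in> Q \<Longrightarrow> D q \<in> borel_measurable M" "\<And>q. q \<in> Q \<Longrightarrow> \<forall>x\<in>space M. 0 \<le> D q x"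
      "\<And>q. q \<in> Q \<Longrightarrow> q = density M (\<lambda>x. ennreal (D q x))"
    and tb: "\<forall>e>0. \<exists>K. finite K \<and> K \<subseteq> Q \<and> Q \<subseteq> (\<Union>k\<in>K. {q\<in>Q. d k q < e})"
    and uc: "AE x in M. \<forall>e>0. \<exists>\<delta>>0. \<forall>p\<in>Q. \<forall>q\<in>Q. d p q < \<delta> \<longrightarrow> \<bar>D p x - D q x\<bar> < e"
    and dom: "integrable M h" "AE x in M. \<forall>q\<in>Q. \<bar>D q x\<bar> \<le> h x"
    and int: "\<And>q. q \<in> Q \<Longrightarrow> integrable q Ystar" "\<And>q. q \<in> Q \<Longrightarrow> (\<integral>\<omega>. Ystar \<omega> \<partial>q) \<le> C"
    and UI: "((\<lambda>a::real. SUP q\<in>Q. \<integral>\<omega>. Ystar \<omega> * indicator {\<omega>. Ystar \<omega> > a} \<omega> \<partial>q) \<longlongrightarrow> 0) at_top"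
    and atomless: "\<forall>t\<in>{0<..T}. atomless_measure (restr_to_subalg M (F t))"
  shows sup_inf_co_measures:
      "(SUP \<tau>\<in>{\<tau>. stopping \<tau>}. INF q\<in>Q. \<integral>\<omega>. Y (\<tau> \<omega>) \<omega> \<partial>q)
        = (SUP \<tau>\<in>{\<tau>. stopping \<tau>}. INF q\<in>co_measures M Q. \<integral>\<omega>. Y (\<tau> \<omega>) \<omega> \<partial>q)"
    and stopping_minimax:
      "(SUP \<tau>\<in>{\<tau>. stopping \<tau>}. INF q\<in>co_measures M Q. \<integral>\<omega>. Y (\<tau> \<omega>) \<omega> \<partial>q)
        = (INF q\<in>co_measures M Q. SUP \<tau>\<in>{\<tau>. stopping \<tau>}. \<integral>\<omega>. Y (\<tau> \<omega>) \<omega> \<partial>q)"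
proof -
  let ?E = "\<lambda>\<tau> q. \<integral>\<omega>. Y (\<tau> \<omega>) \<omega> \<partial>q" and ?ST = "{\<tau>. stopping \<tau>}" and ?co = "co_measures M Q"
  have sq: "sets q = sets M" "space q = space M" if "q \<in> Q" for q
    using D(3)[OF that] by (metis sets_density, metis space_density)
  have si: "integrable q (\<lambda>\<omega>. Y (\<tau> \<omega>) \<omega>)" if "q \<in> Q" "stopping \<tau>" for q \<tau>
    by (rule stopped_integrable[OF sq(1) int(1)]) (use that in auto)
  have bQ: "\<bar>?E \<tau> q\<bar> \<le> C" if q: "q \<in> Q" and \<tau>: "stopping \<tau>" for q \<tau>
  proof -
    have "\<bar>?E \<tau> q\<bar> \<le> (\<integral>\<omega>. \<bar>Y (\<tau> \<omega>) \<omega>\<bar> \<partial>q)" by (rule integral_abs_bound)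
    also have "\<dots> \<le> (\<integral>\<omega>. Ystar \<omega> \<partial>q)"
      using stopped_le_Ystar[OF \<tau>] sq(2)[OF q]
      by (intro integral_mono[OF integrable_abs[OF si[OF q \<tau>]] int(1)[OF q]]) auto
    finally show ?thesis using int(2)[OF q] by simp
  qed
  have Q_co: "q \<in> ?co" if "q \<in> Q" for q
    unfolding co_measures_def using sq(1)[OF that] that
    by (auto intro!: exI[of _ "{q}"] exI[of _ "\<lambda>_. 1"])
  have co: "\<exists>I w. finite I \<and> I \<subseteq> Q \<and> (\<forall>q\<in>I. 0 \<le> w q) \<and> sum w I = (1::real) \<and>
      (\<forall>\<tau>. stopping \<tau> \<longrightarrow> ?E \<tau> N = (\<Sum>q\<in>I. w q * ?E \<tau> q))" if N: "N \<in> ?co" for N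
  proof -
    obtain I w where I: "finite I" "I \<subseteq> Q" "\<And>q. q \<in> I \<Longrightarrow> 0 \<le> w q" "sum w I = 1"
      "\<And>f :: 'a \<Rightarrow> real. f \<in> borel_measurable M \<Longrightarrow> (\<And>q. q \<in> Q \<Longrightarrow> integrable q f) \<Longrightarrow>
        (\<integral>x. f x \<partial>N) = (\<Sum>q\<in>I. w q * (\<integral>x. f x \<partial>q))"
      by (rule co_measures_integral[OF D N]) auto
    then show ?thesis
      using I(5)[OF stopped_measurable si] by (intro exI[of _ I] exI[of _ w]) auto
  qed
  have avg: "c \<le> (\<Sum>q\<in>I. w q * g q)" if "\<forall>q\<in>I. 0 \<le> w q" "sum w I = 1" "\<And>q. q \<in> I \<Longrightarrow> c \<le> g q"
    for I :: "'a measure set" and w g and c :: real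
  proof -
    have "c = (\<Sum>q\<in>I. w q * c)" using that(2) by (simp flip: sum_distrib_right)
    also have "\<dots> \<le> (\<Sum>q\<in>I. w q * g q)" using that by (intro sum_mono mult_left_mono) auto
    finally show ?thesis .
  qed
  have bco: "- C \<le> ?E \<tau> N" "?E \<tau> N \<le> C" if N: "N \<in> ?co" and \<tau>: "stopping \<tau>" for N \<tau>
  proof -
    obtain I w where I: "I \<subseteq> Q" "\<forall>q\<in>I. 0 \<le> w q" "sum w I = 1" "?E \<tau> N = (\<Sum>q\<in>I. w q * ?E \<tau> q)"
      using co[OF N] \<tau> by (elim exE conjE) (erule that, assumption+, erule allE, erule mp)
    have b: "\<bar>?E \<tau> q\<bar> \<le> C" if "q \<in> I" for q using bQ \<tau> I(1) that by blast
    have "- C \<le> (\<Sum>q\<in>I. w q * ?E \<tau> q)" "- C \<le> (\<Sum>q\<in>I. w q * - ?E \<tau> q)"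
      using b by (intro avg[OF I(2,3)]; force simp: abs_le_iff)+
    then show "- C \<le> ?E \<tau> N" "?E \<tau> N \<le> C" using I(4) by (auto simp: sum_negf)
  qed
  have bb: "bdd_below (?E \<tau> ` ?co)" "bdd_below (?E \<tau> ` Q)" if "stopping \<tau>" for \<tau>
    using bco(1)[OF _ that] Q_co by (auto intro!: bdd_belowI[of _ "- C"])
  have inf_eq: "(INF q\<in>Q. ?E \<tau> q) = (INF q\<in>?co. ?E \<tau> q)" if \<tau>: "stopping \<tau>" for \<tau>
  proof (rule antisym)
    show "(INF q\<in>?co. ?E \<tau> q) \<le> (INF q\<in>Q. ?E \<tau> q)"
      using Q_ne Q_co bb(1)[OF \<tau>] by (intro cINF_greatest cINF_lower) auto
    show "(INF q\<in>Q. ?E \<tau> q) \<le> (INF q\<in>?co. ?E \<tau> q)"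
    proof (rule cINF_greatest)
      fix N assume "N \<in> ?co"
      obtain I w where I: "I \<subseteq> Q" "\<forall>q\<in>I. 0 \<le> w q" "sum w I = 1" "?E \<tau> N = (\<Sum>q\<in>I. w q * ?E \<tau> q)"
        using co[OF \<open>N \<in> ?co\<close>] \<tau> by (elim exE conjE) (erule that, assumption+, erule allE, erule mp)
      show "(INF q\<in>Q. ?E \<tau> q) \<le> ?E \<tau> N"
        unfolding I(4) using I(1) bb(2)[OF \<tau>] by (intro avg[OF I(2,3)] cINF_lower) auto
    qed (use Q_ne Q_co in auto)
  qed
  then show first: "(SUP \<tau>\<in>?ST. INF q\<in>Q. ?E \<tau> q) = (SUP \<tau>\<in>?ST. INF q\<in>?co. ?E \<tau> q)"
    by (intro SUP_cong) auto
  have co_ne: "?co \<noteq> {}" using Q_ne Q_co by auto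
  have ST_ne: "?ST \<noteq> {}" using stopping_zero by auto
  have bS: "bdd_above ((\<lambda>\<tau>. ?E \<tau> N) ` ?ST)" if "N \<in> ?co" for N
    using bco(2)[OF that] by (auto intro!: bdd_aboveI[of _ C])
  have bI: "bdd_above ((\<lambda>\<tau>. INF q\<in>Q. ?E \<tau> q) ` ?ST)"
  proof (rule bdd_aboveI2)
    fix \<tau> assume "\<tau> \<in> ?ST"
    moreover obtain q where q: "q \<in> Q" using Q_ne by blast
    ultimately show "(INF q\<in>Q. ?E \<tau> q) \<le> C"
      using bb(2)[of \<tau>] bQ[OF q, of \<tau>] by (intro cINF_lower2[OF _ q]) auto
  qed
  show "(SUP \<tau>\<in>?ST. INF q\<in>?co. ?E \<tau> q) = (INF q\<in>?co. SUP \<tau>\<in>?ST. ?E \<tau> q)"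
  proof (rule antisym)
    show "(SUP \<tau>\<in>?ST. INF q\<in>?co. ?E \<tau> q) \<le> (INF q\<in>?co. SUP \<tau>\<in>?ST. ?E \<tau> q)"
    proof (intro cSUP_least[OF ST_ne] cINF_greatest[OF co_ne])
      fix \<tau> N assume *: "\<tau> \<in> ?ST" "N \<in> ?co"
      have "(INF q\<in>?co. ?E \<tau> q) \<le> ?E \<tau> N" using * bb(1)[of \<tau>] by (intro cINF_lower) auto
      also have "\<dots> \<le> (SUP \<tau>\<in>?ST. ?E \<tau> N)" using * bS by (intro cSUP_upper) auto
      finally show "(INF q\<in>?co. ?E \<tau> q) \<le> (SUP \<tau>\<in>?ST. ?E \<tau> N)" .
    qed
    let ?v = "SUP \<tau>\<in>?ST. INF q\<in>Q. ?E \<tau> q"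
    have "(INF q\<in>?co. SUP \<tau>\<in>?ST. ?E \<tau> q) \<le> ?v"
    proof (rule field_le_epsilon)
      fix e :: real assume e: "0 < e"
      obtain K where K: "finite K" "K \<noteq> {}" "K \<subseteq> Q"
        "\<And>q. q \<in> Q \<Longrightarrow> \<exists>k\<in>K. \<forall>\<tau>. stopping \<tau> \<longrightarrow> \<bar>?E \<tau> q - ?E \<tau> k\<bar> < e / 2"
        using finite_net[OF Q_ne prob D tb uc dom int UI, of "e / 2"] e by auto
      \<comment> \<open>The surplus \<open>e\<close> over \<open>?v\<close> has two halves: one
        because the infimum over \<open>Q\<close> need not be attained, the other for replacing the
        near-minimiser by a point of the net.\<close>
      have "\<exists>w. (\<forall>k\<in>K. 0 \<le> w k) \<and> sum w K = 1 \<and> (\<forall>\<tau>\<in>?ST. (\<Sum>k\<in>K. w k * ?E \<tau> k) \<le> ?v + e)"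
      proof (rule finite_minimax[OF K(1,2)])
        fix u v and l \<epsilon> :: real
        assume *: "u \<in> ?ST" "v \<in> ?ST" "0 \<le> l" "l \<le> 1" "0 < \<epsilon>"
        have "\<exists>\<tau>. stopping \<tau> \<and> (\<forall>k\<in>K. \<bar>?E \<tau> k - (l * ?E u k + (1 - l) * ?E v k)\<bar> < \<epsilon>)"
          by (rule stopped_approx_convex[OF atomless K(1) int(1) D]) (use K(3) * in auto)
        then show "\<exists>\<tau>\<in>?ST. \<forall>k\<in>K. \<bar>?E \<tau> k - (l * ?E u k + (1 - l) * ?E v k)\<bar> < \<epsilon>"
          by blast
      next
        fix \<tau> assume \<tau>: "\<tau> \<in> ?ST"
        have "(INF q\<in>Q. ?E \<tau> q) \<le> ?v" by (rule cSUP_upper[OF \<tau> bI])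
        then have "(INF q\<in>Q. ?E \<tau> q) < ?v + e / 2" using e by linarith
        then obtain q where q: "q \<in> Q" "?E \<tau> q < ?v + e / 2"
          using cINF_less_iff[OF Q_ne bb(2)] \<tau> by auto
        obtain k where k: "k \<in> K" "\<forall>\<tau>. stopping \<tau> \<longrightarrow> \<bar>?E \<tau> q - ?E \<tau> k\<bar> < e / 2"
          using K(4)[OF q(1)] by blast
        then have "\<bar>?E \<tau> q - ?E \<tau> k\<bar> < e / 2" using \<tau> by blast
        then have "?E \<tau> k \<le> ?v + e" using q(2) by linarith
        then show "\<exists>k\<in>K. ?E \<tau> k \<le> ?v + e" using k(1) by blast
      qed
      then obtain w where w: "\<forall>k\<in>K. 0 \<le> w k" "sum w K = 1"
        "\<And>\<tau>. stopping \<tau> \<Longrightarrow> (\<Sum>k\<in>K. w k * ?E \<tau> k) \<le> ?v + e" by blast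
      define N where "N = density M (\<lambda>x. ennreal (\<Sum>q\<in>K. w q * D q x))"
      have "N \<in> ?co"
        unfolding co_measures_def N_def
      proof (intro CollectI conjI exI[of _ K] exI[of _ w] ballI)
        fix A assume "A \<in> sets M"
        then show "emeasure (density M (\<lambda>x. ennreal (\<Sum>q\<in>K. w q * D q x))) A
            = (\<Sum>q\<in>K. ennreal (w q) * emeasure q A)"
          by (rule emeasure_mixture[OF _ D, rotated -1]) (use K w in auto)
      qed (use K w in auto)
      moreover have "?E \<tau> N \<le> ?v + e" if "stopping \<tau>" for \<tau>
      proof -
        have "?E \<tau> N = (\<Sum>k\<in>K. w k * ?E \<tau> k)"
          unfolding N_def
          by (rule integral_mixture[OF _ D stopped_measurable[OF that] si[OF _ that]]) (use K w in auto)
        then show ?thesis using w(3)[OF that] by simp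
      qed
      then have "(SUP \<tau>\<in>?ST. ?E \<tau> N) \<le> ?v + e" by (intro cSUP_least[OF ST_ne]) auto
      \<comment> \<open>Stopping at time 0 bounds each inner supremum from below by
        \<open>- C\<close>.\<close>
      moreover have "bdd_below ((\<lambda>N. SUP \<tau>\<in>?ST. ?E \<tau> N) ` ?co)"
        using bco(1)[OF _ stopping_zero] bS stopping_zero
        by (intro bdd_belowI2[of _ "- C"] cSUP_upper2[where x="\<lambda>_. 0"]) auto
      ultimately show "(INF q\<in>?co. SUP \<tau>\<in>?ST. ?E \<tau> q) \<le> ?v + e"
        by (intro cINF_lower2[of _ _ N]) auto
    qed
    then show "(INF q\<in>?co. SUP \<tau>\<in>?ST. ?E \<tau> q) \<le> (SUP \<tau>\<in>?ST. INF q\<in>?co. ?E \<tau> q)"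
      using first by simp
  qed
qed

end

section \<open>Failure of time consistency\<close>

text \<open>Time consistency speaks only about essential infima that are supplied, so one must be
  produced. The integral of the pointwise infimum is minimised over countable subfamilies: the union
  of a minimising sequence attains the minimum, a further member cannot lower the integral and hence
  changes the infimum only on a null set, and countability lets any other lower bound hold for all
  chosen members at once.\<close>

lemma (in prob_space) ess_inf_exists:
  assumes ne: "S \<noteq> {}" and S: "\<And>X. X \<in> S \<Longrightarrow> X \<in> borel_measurable M"
    and bd: "\<And>X. X \<in> S \<Longrightarrow> AE x in M. \<bar>X x\<bar> \<le> C" and C: "0 \<le> C"
  shows "\<exists>\<eta>. is_ess_inf M S \<eta>"
proof -
  \<comment> \<open>Each member is bounded by \<open>C\<close> only almost surely; clipping makes
    the infima finite and integrable without exceptional points.\<close>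
  define cl where "cl X x = max (- C) (min C (X x))" for X :: "'a \<Rightarrow> real" and x
  define G where "G A x = (INF X\<in>A. cl X x)" for A x
  define \<A> where "\<A> = {A. A \<subseteq> S \<and> countable A \<and> A \<noteq> {}}"
  have clb: "- C \<le> cl X x" "cl X x \<le> C" for X x
    using C by (auto simp: cl_def)
  have bb: "bdd_below ((\<lambda>X. cl X x) ` A)" for A x
    using clb(1) by (intro bdd_belowI2)
  have Gm: "G A \<in> borel_measurable M" if "A \<in> \<A>" for A
    unfolding G_def using that S bb by (intro borel_measurable_cINF) (auto simp: \<A>_def cl_def)
  have Gl: "- C \<le> G A x" "G A x \<le> C" if A: "A \<in> \<A>" for A x
  proof -
    show "- C \<le> G A x" unfolding G_def using A clb(1) by (intro cINF_greatest) (auto simp: \<A>_def)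
    obtain X where "X \<in> A" using A by (auto simp: \<A>_def)
    then show "G A x \<le> C" unfolding G_def using clb(2) bb by (intro cINF_lower2)
  qed
  have Gi: "integrable M (G A)" if "A \<in> \<A>" for A
  proof (rule integrable_const_bound[OF _ Gm[OF that]])
    show "AE x in M. norm (G A x) \<le> C"
      using Gl[OF that] by (auto simp: abs_le_iff minus_le_iff)
  qed
  have \<A>_ne: "\<A> \<noteq> {}"
  proof -
    obtain X where "X \<in> S" using ne by blast
    then have "{X} \<in> \<A>" by (simp add: \<A>_def)
    then show ?thesis by blast
  qed
  have ib: "bdd_below ((\<lambda>A. \<integral>x. G A x \<partial>M) ` \<A>)"
  proof (rule bdd_belowI2)
    fix A assume "A \<in> \<A>"
    then have "(\<integral>x. - C \<partial>M) \<le> (\<integral>x. G A x \<partial>M)"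
      using Gi Gl by (intro integral_mono) auto
    then show "- C \<le> (\<integral>x. G A x \<partial>M)" by (simp add: prob_space)
  qed
  define \<alpha> where "\<alpha> = (INF A\<in>\<A>. \<integral>x. G A x \<partial>M)"
  have "\<exists>A\<in>\<A>. (\<integral>x. G A x \<partial>M) < \<alpha> + 1 / (real n + 1)" for n
    using cINF_less_iff[OF \<A>_ne ib, of "\<alpha> + 1 / (real n + 1)"] by (simp add: \<alpha>_def)
  then obtain A where A: "\<And>n. A n \<in> \<A>" "\<And>n. (\<integral>x. G (A n) x \<partial>M) < \<alpha> + 1 / (real n + 1)"
    by metis
  define B where "B = (\<Union>n :: nat. A n)"
  have B: "B \<in> \<A>" using A(1) unfolding B_def \<A>_def by auto
  have "(\<integral>x. G B x \<partial>M) \<le> \<alpha> + 1 / (real n + 1)" for n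
  proof -
    have "G B x \<le> G (A n) x" for x
      unfolding G_def using A(1)[of n] bb by (intro cINF_superset_mono) (auto simp: \<A>_def B_def)
    then have "(\<integral>x. G B x \<partial>M) \<le> (\<integral>x. G (A n) x \<partial>M)"
      using Gi[OF B] Gi[OF A(1)] by (intro integral_mono) auto
    then show ?thesis using A(2)[of n] by linarith
  qed
  moreover have "(\<lambda>n. \<alpha> + 1 / (real n + 1)) \<longlonglongrightarrow> \<alpha>"
    using tendsto_add[OF tendsto_const LIMSEQ_inverse_real_of_nat, of \<alpha>]
    by (simp add: inverse_eq_divide add.commute)
  ultimately have int_B: "(\<integral>x. G B x \<partial>M) \<le> \<alpha>"
    by (intro LIMSEQ_le_const) auto
  have cl_eq: "AE x in M. cl X x = X x" if "X \<in> S" for X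
    using bd[OF that] by eventually_elim (auto simp: cl_def)
  have "is_ess_inf M S (G B)"
    unfolding is_ess_inf_def
  proof (intro conjI ballI impI)
    show "G B \<in> borel_measurable M" by (rule Gm[OF B])
  next
    fix X assume X: "X \<in> S"
    then have XB: "insert X B \<in> \<A>" using B by (auto simp: \<A>_def)
    have le: "G (insert X B) x \<le> G B x" for x
      unfolding G_def using B bb by (intro cINF_superset_mono) (auto simp: \<A>_def)
    have "\<alpha> \<le> (\<integral>x. G (insert X B) x \<partial>M)" unfolding \<alpha>_def by (rule cINF_lower[OF ib XB])
    moreover have "(\<integral>x. G (insert X B) x \<partial>M) \<le> (\<integral>x. G B x \<partial>M)"
      using Gi[OF B] Gi[OF XB] le by (intro integral_mono) auto
    ultimately have "(\<integral>x. G B x - G (insert X B) x \<partial>M) = 0"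
      using int_B Gi[OF B] Gi[OF XB] by simp
    then have "AE x in M. G B x - G (insert X B) x = 0"
      using Gi[OF B] Gi[OF XB] le by (subst (asm) integral_nonneg_eq_0_iff_AE) auto
    then show "AE x in M. G B x \<le> X x"
      using cl_eq[OF X]
    proof eventually_elim
      case (elim x)
      have "G (insert X B) x \<le> cl X x" unfolding G_def using bb by (intro cINF_lower) auto
      then show ?case using elim by simp
    qed
  next
    fix \<xi> assume \<xi>: "\<xi> \<in> borel_measurable M" "\<forall>X\<in>S. AE x in M. \<xi> x \<le> X x"
    have "AE x in M. \<forall>X\<in>B. \<xi> x \<le> cl X x"
    proof (subst AE_ball_countable)
      show "countable B" using B by (simp add: \<A>_def)
      show "\<forall>X\<in>B. AE x in M. \<xi> x \<le> cl X x"
      proof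
        fix X assume "X \<in> B"
        then have X: "X \<in> S" using B by (auto simp: \<A>_def)
        then have "AE x in M. \<xi> x \<le> X x" using \<xi>(2) by blast
        then show "AE x in M. \<xi> x \<le> cl X x" using cl_eq[OF X] by eventually_elim simp
      qed
    qed
    then show "AE x in M. \<xi> x \<le> G B x"
      using B unfolding G_def \<A>_def by (auto elim!: eventually_mono intro!: cINF_greatest)
  qed
  then show ?thesis by blast
qed

text \<open>Intended for a variable already known at the time of conditioning, whose conditional
  expectations all agree with it almost surely.\<close>

lemma is_ess_inf_AE_eq:
  assumes "S \<noteq> {}" "Z \<in> borel_measurable M" "\<And>X. X \<in> S \<Longrightarrow> AE x in M. X x = Z x"
  shows "is_ess_inf M S Z"
  unfolding is_ess_inf_def
proof (intro conjI ballI impI assms(2))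
  fix X assume "X \<in> S"
  from assms(3)[OF this] show "AE x in M. Z x \<le> X x" by eventually_elim simp
next
  fix \<xi> assume "\<forall>X\<in>S. AE x in M. \<xi> x \<le> X x"
  moreover obtain X where X: "X \<in> S" using assms(1) by blast
  ultimately have "AE x in M. \<xi> x \<le> X x" by blast
  with assms(3)[OF X] show "AE x in M. \<xi> x \<le> Z x" by eventually_elim simp
qed

text \<open>The infimum of the constants need not be attained, so a competing lower bound is
  compared with the infimum plus \<open>1 / (n + 1)\<close> for every \<open>n\<close>; only
  countably many null sets arise.\<close>

lemma is_ess_inf_const:
  assumes ne: "Q \<noteq> {}" and bdd: "bdd_below (m ` Q)" and f: "\<And>q. q \<in> Q \<Longrightarrow> AE x in M. f q x = m q"
  shows "is_ess_inf M (f ` Q) (\<lambda>_. INF q\<in>Q. m q)"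
  unfolding is_ess_inf_def
proof (intro conjI ballI impI)
  fix X assume "X \<in> f ` Q"
  then obtain q where q: "q \<in> Q" "X = f q" by blast
  from f[OF q(1)] show "AE x in M. (INF q\<in>Q. m q) \<le> X x"
    by eventually_elim (use cINF_lower[OF bdd q(1)] q(2) in simp)
next
  fix \<xi> assume \<xi>: "\<forall>X\<in>f ` Q. AE x in M. \<xi> x \<le> X x"
  have "AE x in M. \<forall>n::nat. \<xi> x \<le> (INF q\<in>Q. m q) + 1 / (real n + 1)"
  proof (subst AE_all_countable, rule allI)
    fix n :: nat
    obtain q where q: "q \<in> Q" "m q < (INF q\<in>Q. m q) + 1 / (real n + 1)"
      using cINF_less_iff[OF ne bdd, of "(INF q\<in>Q. m q) + 1 / (real n + 1)"] by auto
    have "AE x in M. \<xi> x \<le> f q x" using \<xi> q(1) by blast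
    with f[OF q(1)] show "AE x in M. \<xi> x \<le> (INF q\<in>Q. m q) + 1 / (real n + 1)"
      by eventually_elim (use q(2) in simp)
  qed
  moreover have "(\<lambda>n. (INF q\<in>Q. m q) + 1 / (real n + 1)) \<longlonglongrightarrow> (INF q\<in>Q. m q)"
    using tendsto_add[OF tendsto_const LIMSEQ_inverse_real_of_nat, of "INF q\<in>Q. m q"]
    by (simp add: inverse_eq_divide add.commute)
  ultimately show "AE x in M. \<xi> x \<le> (INF q\<in>Q. m q)"
    by (auto elim!: eventually_mono intro!: LIMSEQ_le_const)
qed simp

section \<open>Conditional expectations under equivalent measures\<close>

locale equivalent_measures = filtered_prob_space M F T
  for M :: "'a measure" and F T +
  fixes Q :: "'a measure set" and D :: "'a measure \<Rightarrow> 'a \<Rightarrow> real"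
  assumes Q_prob: "\<And>q. q \<in> Q \<Longrightarrow> prob_space q"
    and D: "\<And>q. q \<in> Q \<Longrightarrow> D q \<in> borel_measurable M" "\<And>q. q \<in> Q \<Longrightarrow> \<forall>x\<in>space M. 0 \<le> D q x"
      "\<And>q. q \<in> Q \<Longrightarrow> q = density M (\<lambda>x. ennreal (D q x))"
    and equiv: "\<And>q. q \<in> Q \<Longrightarrow> absolutely_continuous M q" "\<And>q. q \<in> Q \<Longrightarrow> absolutely_continuous q M"
begin

text \<open>Conditioning at a deterministic time goes through its stopped \<sigma>-algebra, the form
  in which \<open>time_consistent\<close> asks for it.\<close>

abbreviation E\<^sub>c :: "'a measure \<Rightarrow> real \<Rightarrow> ('a \<Rightarrow> real) \<Rightarrow> 'a \<Rightarrow> real" where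
  "E\<^sub>c q t \<equiv> real_cond_exp q (stopped_sigma M F T (\<lambda>_. t))"

lemma sets_Q: "q \<in> Q \<Longrightarrow> sets q = sets M"
  using D(3) by (metis sets_density)

lemma space_Q: "q \<in> Q \<Longrightarrow> space q = space M"
  using D(3) by (metis space_density)

lemma AE_Q: "q \<in> Q \<Longrightarrow> (AE x in q. P x) \<longleftrightarrow> (AE x in M. P x)"
  using absolutely_continuous_AE[OF sets_Q equiv(1)] absolutely_continuous_AE[OF sets_Q[symmetric] equiv(2)]
  by blast

lemma measurable_Q: "q \<in> Q \<Longrightarrow> f \<in> borel_measurable q \<longleftrightarrow> f \<in> borel_measurable M"
  using measurable_cong_sets[OF sets_Q refl] by blast

lemma integrable_Q:
  assumes "q \<in> Q" "f \<in> borel_measurable M" "AE x in M. \<bar>f x\<bar> \<le> (C :: real)"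
  shows "integrable q f"
proof -
  interpret q: prob_space q by (rule Q_prob[OF assms(1)])
  show ?thesis
    using assms by (intro q.integrable_const_bound[of _ C]) (auto simp: AE_Q measurable_Q)
qed

lemma integrable_D: "q \<in> Q \<Longrightarrow> integrable M (D q)"
  using integrable_Q[of q "\<lambda>_. 1" 1] integrable_wrt_density[OF D(3,1,2), of q "\<lambda>_. 1"] by simp

lemma integral_D: "q \<in> Q \<Longrightarrow> (\<integral>x. D q x \<partial>M) = 1"
  using integral_wrt_density[OF D(3,1,2), of q "\<lambda>_. 1"] prob_space.prob_space[OF Q_prob] by simp

lemma sets_stopped_sigma_const:
  assumes t: "0 \<le> t" "t \<le> T"
  shows "sets (stopped_sigma M F T (\<lambda>_. t)) = sets (F t)"
proof -
  have "{A \<in> sets M. \<forall>s\<in>{0..T}. A \<inter> {\<omega>\<in>space M. t \<le> s} \<in> sets (F s)} = sets (F t)" (is "?S = _")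
  proof (intro equalityI subsetI)
    fix A assume "A \<in> ?S"
    then have AM: "A \<in> sets M" and all: "\<forall>s\<in>{0..T}. A \<inter> {\<omega>\<in>space M. t \<le> s} \<in> sets (F s)" by auto
    have "A \<inter> {\<omega>\<in>space M. t \<le> t} \<in> sets (F t)" by (rule bspec[OF all]) (use t in simp)
    moreover have "A \<inter> {\<omega>\<in>space M. t \<le> t} = A" using sets.sets_into_space[OF AM] by auto
    ultimately show "A \<in> sets (F t)" by simp
  next
    fix A assume A: "A \<in> sets (F t)"
    then have AM: "A \<in> sets M" by (rule sets_F[OF t])
    have "A \<inter> {\<omega>\<in>space M. t \<le> s} \<in> sets (F s)" if s: "s \<in> {0..T}" for s
    proof (cases "t \<le> s")
      case True
      then have "A \<in> sets (F s)" using F_mono t s A by (meson atLeastAtMost_iff subsetD)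
      then show ?thesis using True AM by (simp add: sets.Int_space_eq2)
    qed simp
    then show "A \<in> ?S" using AM by simp
  qed
  then show ?thesis
    unfolding stopped_sigma_def using sets.sigma_sets_eq[of "F t"] space_F[OF t] sets.space_closed[of "F t"]
    by (simp add: sets_measure_of)
qed

lemma space_stopped_sigma: "space (stopped_sigma M F T \<sigma>) = space M"
  unfolding stopped_sigma_def by (simp add: space_measure_of_conv)

lemma subalgebra_stopped:
  assumes "0 \<le> t" "t \<le> T"
  shows "subalgebra M (stopped_sigma M F T (\<lambda>_. t))"
  using sets_stopped_sigma_const[OF assms] sets_F[OF assms] space_stopped_sigma
  by (auto simp: subalgebra_def)

lemma cond_exp_subalgebra:
  assumes "q \<in> Q" "0 \<le> t" "t \<le> T"
  shows "finite_measure_subalgebra q (stopped_sigma M F T (\<lambda>_. t))"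
proof -
  interpret q: prob_space q by (rule Q_prob[OF assms(1)])
  show ?thesis
    using subalgebra_stopped[OF assms(2,3)] sets_Q[OF assms(1)] space_Q[OF assms(1)]
    by unfold_locales (simp add: subalgebra_def)
qed

lemma cond_exp_measurable:
  assumes "0 \<le> t" "t \<le> T"
  shows "E\<^sub>c q t X \<in> borel_measurable M"
  by (rule measurable_from_subalg[OF subalgebra_stopped[OF assms] borel_measurable_cond_exp])

lemma cond_exp_bounds:
  assumes q: "q \<in> Q" and t: "0 \<le> t" "t \<le> T" and X: "X \<in> borel_measurable M"
    and ab: "AE x in M. a \<le> X x \<and> X x \<le> b"
  shows "AE x in M. a \<le> E\<^sub>c q t X x \<and> E\<^sub>c q t X x \<le> b"
proof -
  interpret finite_measure_subalgebra q "stopped_sigma M F T (\<lambda>_. t)"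
    by (rule cond_exp_subalgebra[OF q t])
  have "AE x in M. \<bar>X x\<bar> \<le> max \<bar>a\<bar> \<bar>b\<bar>" using ab by eventually_elim auto
  then have i: "integrable q X" by (rule integrable_Q[OF q X])
  have "AE x in M. a \<le> E\<^sub>c q t X x" "AE x in M. E\<^sub>c q t X x \<le> b"
    using real_cond_exp_ge_c[OF i, of a] real_cond_exp_le_c[OF i, of b] ab by (auto simp: AE_Q[OF q])
  then show ?thesis by eventually_elim simp
qed

end

lemma AE_eq_integral_le:
  fixes f g :: "'a \<Rightarrow> real"
  assumes "integrable N f" "integrable N g" "AE x in N. f x \<le> g x" "(\<integral>x. f x \<partial>N) = (\<integral>x. g x \<partial>N)"
  shows "AE x in N. f x = g x"
proof -
  have "AE x in N. g x - f x = 0"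
    using assms by (subst integral_nonneg_eq_0_iff_AE[symmetric]) auto
  then show ?thesis by eventually_elim simp
qed

lemma ess_bounded_AE_le:
  assumes "X \<in> borel_measurable M" "AE x in M. \<bar>X x\<bar> \<le> C"
  shows "ess_bounded M X"
  using assms unfolding ess_bounded_def by blast

context equivalent_measures
begin

text \<open>Events of \<open>F 0\<close> are null or full under \<open>M\<close>, hence under
  \<open>q\<close> by equivalence, so over each of them \<open>X\<close> and its mean have the same
  integral.\<close>

lemma cond_exp_time_0:
  assumes q: "q \<in> Q" and X: "X \<in> borel_measurable M" "AE x in M. \<bar>X x\<bar> \<le> C"
    and triv: "\<forall>A\<in>sets (F 0). measure M A = 0 \<or> measure M A = 1"
  shows "AE x in M. E\<^sub>c q 0 X x = (\<integral>x. X x \<partial>q)"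
proof -
  interpret q: prob_space q by (rule Q_prob[OF q])
  interpret finite_measure_subalgebra q "stopped_sigma M F T (\<lambda>_. 0)"
    by (rule cond_exp_subalgebra[OF q]) (use T_pos in auto)
  let ?c = "\<integral>x. X x \<partial>q"
  have i: "integrable q X" by (rule integrable_Q[OF q X])
  have "AE x in q. E\<^sub>c q 0 X x = ?c"
  proof (rule real_cond_exp_charact[OF _ i])
    fix A assume "A \<in> sets (stopped_sigma M F T (\<lambda>_. 0))"
    then have A: "A \<in> sets (F 0)" using sets_stopped_sigma_const[of 0] T_pos by simp
    then have AM: "A \<in> sets M" using sets_F[of 0] T_pos by simp
    then have Aq: "A \<in> sets q" using sets_Q[OF q] by simp
    consider "AE x in q. x \<notin> A" | "AE x in q. x \<in> A"
      using triv A prob_eq_0[OF AM] prob_eq_1[OF AM] AE_Q[OF q] by blast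
    then show "(\<integral>x\<in>A. X x \<partial>q) = (\<integral>x\<in>A. ?c \<partial>q)"
    proof cases
      case 1
      have "(\<integral>x\<in>A. g x \<partial>q) = 0" for g :: "'a \<Rightarrow> real"
        unfolding set_lebesgue_integral_def
        by (rule integral_eq_zero_AE) (use 1 in \<open>auto elim: eventually_mono\<close>)
      then show ?thesis by simp
    next
      case 2
      have "(\<integral>x\<in>A. g x \<partial>q) = (\<integral>x. g x \<partial>q)" if "g \<in> borel_measurable q" for g :: "'a \<Rightarrow> real"
        unfolding set_lebesgue_integral_def
        by (rule integral_cong_AE) (use 2 Aq that in \<open>auto elim: eventually_mono\<close>)
      then show ?thesis using i by (simp add: q.prob_space)
    qed
  qed auto
  then show ?thesis using AE_Q[OF q] by simp
qed

text \<open>Both densities have integral 1, which turns an almost sure inequality between them into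
  an equality.\<close>

lemma Q_eqI:
  assumes "q1 \<in> Q" "q2 \<in> Q" "AE x in M. D q1 x \<le> D q2 x"
  shows "q1 = q2"
proof -
  have "AE x in M. D q1 x = D q2 x"
    using assms by (intro AE_eq_integral_le integrable_D) (auto simp: integral_D)
  then have "density M (\<lambda>x. ennreal (D q1 x)) = density M (\<lambda>x. ennreal (D q2 x))"
    using D(1)[OF assms(1)] D(1)[OF assms(2)] by (intro density_cong) (auto elim: eventually_mono)
  then show ?thesis using D(3)[OF assms(1)] D(3)[OF assms(2)] by simp
qed

text \<open>
  For \<open>A = {D q2 \<le> D q1}\<close>, if \<open>g\<close> were a common version of the conditional probability of \<open>A\<close>,
  then \<open>(1\<^sub>A - g) (D q1 - D q2) \<ge> 0\<close> would have integral zero, forcing \<open>g = 1\<^sub>A\<close>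
  and hence measurability of \<open>A\<close> at every positive time; right continuity and triviality at time
  zero would then give \<open>q1 = q2\<close>.
\<close>

lemma distinct_conditional_probabilities:
  assumes q: "q1 \<in> Q" "q2 \<in> Q" "q1 \<noteq> q2"
    and rcont: "\<forall>t\<in>{0..<T}. sets (F t) = (\<Inter>s\<in>{t<..T}. sets (F s))"
    and triv: "\<forall>A\<in>sets (F 0). measure M A = 0 \<or> measure M A = 1"
    and null: "\<forall>A\<in>sets M. measure M A = 0 \<longrightarrow> A \<in> sets (F 0)"
  shows "\<exists>t\<in>{0<..T}. \<exists>A\<in>sets M. \<not> (AE x in M. E\<^sub>c q1 t (indicator A) x = E\<^sub>c q2 t (indicator A) x)"
proof (rule ccontr)
  assume contr: "\<not> ?thesis"
  note Dm = D(1)[OF q(1)] D(1)[OF q(2)]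
  define A where "A = {x\<in>space M. D q2 x \<le> D q1 x}"
  have A: "A \<in> sets M" unfolding A_def using Dm by measurable
  let ?i = "indicator A :: 'a \<Rightarrow> real"
  have "A \<in> sets (F t)" if t: "t \<in> {0<..T}" for t
  proof -
    let ?G = "stopped_sigma M F T (\<lambda>_. t)"
    have t': "0 \<le> t" "t \<le> T" using t by auto
    \<comment> \<open>Clipping changes the version only on a null set and makes the bounds hold at
      every point, where the signs are compared.\<close>
    define g where "g x = max 0 (min 1 (E\<^sub>c q1 t ?i x))" for x
    have gG: "g \<in> borel_measurable ?G"
      unfolding g_def by (intro borel_measurable_max borel_measurable_min borel_measurable_cond_exp) auto
    have gM: "g \<in> borel_measurable M"
      by (rule measurable_from_subalg[OF subalgebra_stopped[OF t'] gG])
    have g01: "0 \<le> g x" "g x \<le> 1" for x by (auto simp: g_def)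
    have eq1: "AE x in M. g x = E\<^sub>c q1 t ?i x"
      using cond_exp_bounds[OF q(1) t', of ?i 0 1] A
      by (auto simp: g_def indicator_def elim: eventually_mono)
    have eq2: "AE x in M. g x = E\<^sub>c q2 t ?i x"
    proof -
      have "AE x in M. E\<^sub>c q1 t ?i x = E\<^sub>c q2 t ?i x" using contr t A by blast
      with eq1 show ?thesis by eventually_elim simp
    qed
    have int0: "(\<integral>x. ?i x - g x \<partial>p) = 0" if p: "p \<in> Q" and eq: "AE x in M. g x = E\<^sub>c p t ?i x" for p
    proof -
      interpret finite_measure_subalgebra p ?G by (rule cond_exp_subalgebra[OF p t'])
      have i: "integrable p ?i" "integrable p g"
        using A gM g01 by (auto intro!: integrable_Q[OF p, of _ 1] simp: indicator_def)
      have "(\<integral>x. g x \<partial>p) = (\<integral>x. E\<^sub>c p t ?i x \<partial>p)"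
        using eq i real_cond_exp_int(1)[OF i(1)] by (intro integral_cong_AE) (auto simp: AE_Q[OF p])
      then show ?thesis using real_cond_exp_int(2)[OF i(1)] i by simp
    qed
    have igm: "(\<lambda>x. ?i x - g x) \<in> borel_measurable M" using A gM by simp
    have iM: "integrable M (\<lambda>x. D p x * (?i x - g x))" if p: "p \<in> Q" for p
    proof -
      have "integrable p (\<lambda>x. ?i x - g x)"
        using igm g01 by (intro integrable_Q[OF p, of _ 1]) (auto simp: indicator_def)
      then show ?thesis using integrable_wrt_density[OF D(3,1,2) igm] p by blast
    qed
    have int0': "(\<integral>x. D p x * (?i x - g x) \<partial>M) = (\<integral>x. ?i x - g x \<partial>p)" if p: "p \<in> Q" for p
      by (rule integral_wrt_density[OF D(3,1,2) igm, symmetric]) (use p in auto)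
    have "AE x in M. D q2 x * (?i x - g x) = D q1 x * (?i x - g x)"
    proof (rule AE_eq_integral_le[OF iM[OF q(2)] iM[OF q(1)]])
      show "AE x in M. D q2 x * (?i x - g x) \<le> D q1 x * (?i x - g x)"
      proof (rule AE_I2)
        fix x assume "x \<in> space M"
        then show "D q2 x * (?i x - g x) \<le> D q1 x * (?i x - g x)"
          using g01[of x] mult_right_mono[of "D q2 x" "D q1 x" "1 - g x"]
            mult_right_mono_neg[of "D q1 x" "D q2 x" "- g x"]
          by (cases "x \<in> A") (simp_all add: A_def)
      qed
      show "(\<integral>x. D q2 x * (?i x - g x) \<partial>M) = (\<integral>x. D q1 x * (?i x - g x) \<partial>M)"
        unfolding int0'[OF q(1)] int0'[OF q(2)] int0[OF q(1) eq1] int0[OF q(2) eq2] ..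
    qed
    \<comment> \<open>Off \<open>A\<close> the densities differ strictly, so equality of the
      products forces \<open>g = 0\<close> there.\<close>
    then have off: "AE x in M. g x \<le> ?i x"
    proof (rule AE_mp[OF _ AE_I2], intro impI)
      fix x assume x: "x \<in> space M" "D q2 x * (?i x - g x) = D q1 x * (?i x - g x)"
      show "g x \<le> ?i x"
      proof (cases "x \<in> A")
        case False
        then have "D q2 x \<noteq> D q1 x" using x(1) by (auto simp: A_def)
        then show ?thesis using x(2) by simp
      qed (use g01 in simp)
    qed
    \<comment> \<open>On \<open>A\<close> the densities may agree, and the products then carry no
      information; equality of the \<open>q1\<close>-integrals closes this case.\<close>
    have "AE x in q1. g x = ?i x"
    proof (rule AE_eq_integral_le)
      show i: "integrable q1 ?i" "integrable q1 g"
        using A gM g01 by (auto intro!: integrable_Q[OF q(1), of _ 1] simp: indicator_def)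
      show "(\<integral>x. g x \<partial>q1) = (\<integral>x. ?i x \<partial>q1)" using int0[OF q(1) eq1] i by simp
    qed (use off AE_Q[OF q(1)] in simp)
    then have gA: "AE x in M. g x = ?i x" using AE_Q[OF q(1)] by simp
    \<comment> \<open>The level \<open>1 / 2\<close> rounds \<open>g\<close> to an event of
      \<open>F t\<close> that differs from \<open>A\<close> by null sets, and these belong to
      \<open>F 0\<close>.\<close>
    define B where "B = {x\<in>space M. 1 / 2 < g x}"
    have "B = {x\<in>space ?G. 1 / 2 < g x}" by (simp add: B_def space_stopped_sigma)
    also have "\<dots> \<in> sets ?G" using gG by measurable
    finally have B: "B \<in> sets (F t)" using sets_stopped_sigma_const[OF t'] by simp
    then have BM: "B \<in> sets M" by (rule sets_F[OF t'])
    have nullF: "N \<in> sets (F t)" if "N \<in> sets M" "AE x in M. x \<notin> N" for N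
    proof -
      have "N \<in> sets (F 0)" using null that prob_eq_0[OF that(1)] by blast
      then show ?thesis using F_mono t' by blast
    qed
    have "A - B \<in> sets (F t)" "B - A \<in> sets (F t)"
      using A BM gA sets.sets_into_space[OF A]
      by (auto intro!: nullF simp: B_def elim!: eventually_mono)
    then have "(B - (B - A)) \<union> (A - B) \<in> sets (F t)" using B by blast
    moreover have "(B - (B - A)) \<union> (A - B) = A" by blast
    ultimately show ?thesis by simp
  qed
  moreover have "sets (F 0) = (\<Inter>s\<in>{0<..T}. sets (F s))" using rcont T_pos by simp
  ultimately have "A \<in> sets (F 0)" by blast
  then consider "AE x in M. x \<notin> A" | "AE x in M. x \<in> A"
    using triv prob_eq_0[OF A] prob_eq_1[OF A] by blast
  then show False
  proof cases
    case 1
    then have "AE x in M. D q1 x \<le> D q2 x"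
      by (rule AE_mp[OF _ AE_I2]) (auto simp: A_def)
    then show False using Q_eqI q by blast
  next
    case 2
    then have "AE x in M. D q2 x \<le> D q1 x" by eventually_elim (simp add: A_def)
    then show False using Q_eqI q by blast
  qed
qed

section \<open>From a conditional gap to the failure of time consistency\<close>

text \<open>\<open>V\<close> centres the indicator of \<open>A\<close> at the midpoint of its two
  conditional probabilities, so on \<open>B\<close> the measures \<open>q1\<close> and
  \<open>q2\<close> give it conditional means of opposite sign and modulus above
  \<open>\<delta>\<close>. Whichever sign multiplies \<open>V\<close>, one of them yields at most
  \<open>- \<delta>\<close>, so at time \<open>t\<close> the lower expectation of \<open>X\<close>
  is at most \<open>Z\<close>. A balanced sign nevertheless keeps every expectation of
  \<open>X\<close> above \<open>- \<kappa> / 4\<close>, while the lower expectation of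
  \<open>Z\<close> at time 0 is at most \<open>- \<kappa>\<close>.\<close>

lemma not_time_consistent_if_conditional_gap:
  assumes q: "q1 \<in> Q" "q2 \<in> Q" and t: "0 < t" "t \<le> T" and A: "A \<in> sets M"
    and gap: "\<not> (AE x in M. E\<^sub>c q2 t (indicator A) x \<le> E\<^sub>c q1 t (indicator A) x)"
    and atomless: "atomless_measure (restr_to_subalg M (F t))"
    and triv: "\<forall>A\<in>sets (F 0). measure M A = 0 \<or> measure M A = 1"
    and net: "\<And>e. 0 < e \<Longrightarrow> \<exists>K. finite K \<and> K \<subseteq> Q \<and>
      (\<forall>q\<in>Q. \<exists>k\<in>K. (\<integral>x. \<bar>D q x - D k x\<bar> \<partial>M) < e)"
  shows "\<not> time_consistent M F T Q"
proof
  assume tc: "time_consistent M F T Q"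
  let ?G = "stopped_sigma M F T (\<lambda>_. t)" and ?i = "indicator A :: 'a \<Rightarrow> real"
  have t': "0 \<le> t" using t by simp
  define g1 where "g1 = E\<^sub>c q1 t ?i"
  define g2 where "g2 = E\<^sub>c q2 t ?i"
  have gG[measurable]: "g1 \<in> borel_measurable ?G" "g2 \<in> borel_measurable ?G"
    unfolding g1_def g2_def by simp_all
  have gM: "g1 \<in> borel_measurable M" "g2 \<in> borel_measurable M"
    using measurable_from_subalg[OF subalgebra_stopped[OF t' t(2)]] gG by blast+
  have g01: "AE x in M. 0 \<le> g1 x \<and> g1 x \<le> 1" "AE x in M. 0 \<le> g2 x \<and> g2 x \<le> 1"
    unfolding g1_def g2_def using A
    by (auto intro!: cond_exp_bounds[OF q(1) t' t(2)] cond_exp_bounds[OF q(2) t' t(2)]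
      simp: indicator_def simp del: AE_conj_iff)
  \<comment> \<open>The gap is made quantitative; the factor 2 anticipates the midpoint, which
    halves the distance.\<close>
  have "\<exists>n::nat. \<not> (AE x in M. g2 x \<le> g1 x + 2 * (1 / (real n + 1)))"
  proof (rule ccontr)
    assume "\<nexists>n::nat. \<not> (AE x in M. g2 x \<le> g1 x + 2 * (1 / (real n + 1)))"
    then have "AE x in M. \<forall>n::nat. g2 x \<le> g1 x + 2 * (1 / (real n + 1))"
      by (subst AE_all_countable) blast
    moreover have lim: "(\<lambda>n. y + 2 * (1 / (real n + 1))) \<longlonglongrightarrow> y" for y :: real
      using tendsto_add[OF tendsto_const tendsto_mult_right_zero[OF LIMSEQ_inverse_real_of_nat], of y 2]
      by (simp add: inverse_eq_divide add.commute)
    ultimately have "AE x in M. g2 x \<le> g1 x"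
      by (elim eventually_mono) (rule LIMSEQ_le_const[OF lim], blast)
    then show False using gap by (simp add: g1_def g2_def)
  qed
  then obtain \<delta> :: real where \<delta>: "0 < \<delta>" "\<not> (AE x in M. g2 x \<le> g1 x + 2 * \<delta>)"
  proof (elim exE)
    fix n :: nat
    assume n: "\<not> (AE x in M. g2 x \<le> g1 x + 2 * (1 / (real n + 1)))"
    show thesis by (rule that[OF _ n]) simp
  qed
  define B where "B = {x\<in>space M. g1 x + 2 * \<delta> < g2 x}"
  have "B = {x\<in>space ?G. g1 x + 2 * \<delta> < g2 x}" by (simp add: B_def space_stopped_sigma)
  also have "\<dots> \<in> sets ?G" by measurable
  finally have BG: "B \<in> sets ?G" .
  then have BM: "B \<in> sets M" using subalgebra_stopped[OF t' t(2)] by (auto simp: subalgebra_def)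
  have "\<not> (AE x in M. x \<notin> B)"
  proof
    assume "AE x in M. x \<notin> B"
    then have "AE x in M. g2 x \<le> g1 x + 2 * \<delta>"
      by (rule AE_mp[OF _ AE_I2]) (auto simp: B_def)
    then show False using \<delta>(2) by blast
  qed
  then have "measure q1 B \<noteq> 0"
    using prob_space.prob_eq_0[OF Q_prob[OF q(1)], of B] BM AE_Q[OF q(1)] sets_Q[OF q(1)] by simp
  then have qB: "0 < measure q1 B" by (simp add: zero_less_measure_iff)
  \<comment> \<open>\<open>- \<kappa>\<close> is the expectation of \<open>Z\<close> under
    \<open>q1\<close>, a number fixed before the sign is chosen.\<close>
  define \<kappa> where "\<kappa> = \<delta> * measure q1 B"
  have \<kappa>: "0 < \<kappa>" using \<delta>(1) qB by (simp add: \<kappa>_def)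
  define V where "V x = ?i x - (g1 x + g2 x) / 2" for x
  have Vm: "V \<in> borel_measurable M" unfolding V_def using gM A by measurable
  have V1: "AE x in M. \<bar>V x\<bar> \<le> 1"
    using g01 by eventually_elim (auto simp: V_def indicator_def abs_le_iff)
  define \<phi> where "\<phi> C x = (2 * indicator C x - 1) * (indicator B x :: real)" for C x
  have \<phi>1: "\<bar>\<phi> C x\<bar> \<le> 1" for C x by (auto simp: \<phi>_def indicator_def)
  have fin: "finite_measure M" by (rule finite_measure_axioms)
  \<comment> \<open>Less than a quarter of \<open>\<kappa>\<close> is spent:
    \<open>\<kappa> / 8\<close> for the distance to the net, and \<open>\<kappa> / 8\<close> for the
    sign, where the factor 2 in \<open>\<phi>\<close> doubles the error
    \<open>\<kappa> / 16\<close>.\<close>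
  obtain K where K: "finite K" "K \<subseteq> Q" "\<And>q. q \<in> Q \<Longrightarrow> \<exists>k\<in>K. (\<integral>x. \<bar>D q x - D k x\<bar> \<partial>M) < \<kappa> / 8"
    using net[of "\<kappa> / 8"] \<kappa> by auto
  define f where "f k x = D k x * (indicator B x * V x)" for k x
  have BVm: "(\<lambda>x. indicator B x * V x) \<in> borel_measurable M" using BM Vm by measurable
  have bound_int: "integrable p X" if "p \<in> Q" "X \<in> borel_measurable M" "AE x in M. \<bar>X x\<bar> \<le> (1::real)" for p X
    using integrable_Q that by blast
  have fi: "integrable M (f k)" if k: "k \<in> Q" for k
  proof -
    have "integrable k (\<lambda>x. indicator B x * V x)"
      using V1 by (intro bound_int[OF k BVm]) (auto elim!: eventually_mono simp: indicator_def)
    then show ?thesis unfolding f_def using integrable_wrt_density[OF D(3,1,2) BVm] k by blast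
  qed
  \<comment> \<open>Weight \<open>1 / 2\<close> balances the sign: about half of each integral is
    counted positively and half negatively.\<close>
  obtain C where C: "C \<in> sets (F t)"
    "\<forall>k\<in>K. \<bar>(\<integral>x. indicator C x * f k x \<partial>M) - 1 / 2 * (\<integral>x. f k x \<partial>M)\<bar> < \<kappa> / 16"
    using atomless_subalg_approx_convexity[OF fin _ atomless K(1), of f "1 / 2" "\<kappa> / 16"]
      F_sub t fi K(2) \<kappa> by auto
  have CG: "C \<in> sets ?G" using C(1) sets_stopped_sigma_const[OF t' t(2)] by simp
  have CM: "C \<in> sets M" by (rule sets_F[OF t' t(2) C(1)])
  have \<phi>G: "\<phi> C \<in> borel_measurable ?G" unfolding \<phi>_def using CG BG by measurable
  have \<phi>M: "\<phi> C \<in> borel_measurable M"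
    by (rule measurable_from_subalg[OF subalgebra_stopped[OF t' t(2)] \<phi>G])
  define X where "X x = \<phi> C x * V x" for x
  have Xm: "X \<in> borel_measurable M" unfolding X_def using \<phi>M Vm by measurable
  have X1: "AE x in M. \<bar>X x\<bar> \<le> 1"
    using V1 by eventually_elim (use \<phi>1 in \<open>auto simp: X_def abs_mult intro!: mult_le_one\<close>)
  define Z where "Z x = - \<delta> * indicator B x" for x :: 'a
  have ZG: "Z \<in> borel_measurable ?G" unfolding Z_def using BG by measurable
  have Zm: "Z \<in> borel_measurable M" by (rule measurable_from_subalg[OF subalgebra_stopped[OF t' t(2)] ZG])
  have Z\<delta>: "AE x in M. \<bar>Z x\<bar> \<le> \<delta>" using \<delta>(1) by (auto simp: Z_def indicator_def)
  have condX: "AE x in M. E\<^sub>c p t X x = \<phi> C x * E\<^sub>c p t V x" if p: "p \<in> Q" for p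
  proof -
    interpret finite_measure_subalgebra p ?G by (rule cond_exp_subalgebra[OF p t' t(2)])
    have "AE x in p. E\<^sub>c p t (\<lambda>x. \<phi> C x * V x) x = \<phi> C x * E\<^sub>c p t V x"
      using \<phi>G Vm bound_int[OF p Xm X1] measurable_Q[OF p] by (intro real_cond_exp_mult) (auto simp: X_def)
    then show ?thesis unfolding X_def using AE_Q[OF p] by simp
  qed
  have condV: "AE x in M. E\<^sub>c p t V x = E\<^sub>c p t ?i x - (g1 x + g2 x) / 2" if p: "p \<in> Q" for p
  proof -
    interpret finite_measure_subalgebra p ?G by (rule cond_exp_subalgebra[OF p t' t(2)])
    have i: "integrable p ?i" "integrable p (\<lambda>x. (g1 x + g2 x) / 2)"
    proof -
      show "integrable p ?i" using A by (intro bound_int[OF p]) (auto simp: indicator_def)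
      have "AE x in M. \<bar>(g1 x + g2 x) / 2\<bar> \<le> 1" using g01 by eventually_elim auto
      then show "integrable p (\<lambda>x. (g1 x + g2 x) / 2)" using gM by (intro bound_int[OF p]) auto
    qed
    have "AE x in p. E\<^sub>c p t V x = E\<^sub>c p t ?i x - E\<^sub>c p t (\<lambda>x. (g1 x + g2 x) / 2) x"
      unfolding V_def by (rule real_cond_exp_diff[OF i])
    moreover have "AE x in p. E\<^sub>c p t (\<lambda>x. (g1 x + g2 x) / 2) x = (g1 x + g2 x) / 2"
      by (rule real_cond_exp_F_meas[OF i(2)]) measurable
    ultimately have "AE x in p. E\<^sub>c p t V x = E\<^sub>c p t ?i x - (g1 x + g2 x) / 2"
      by eventually_elim simp
    then show ?thesis using AE_Q[OF p] by simp
  qed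
  have Q_ne: "Q \<noteq> {}" using q by blast
  obtain a where a: "is_ess_inf_cond_exp M F T Q (\<lambda>_. t) X a"
  proof -
    have "\<exists>\<eta>. is_ess_inf M ((\<lambda>q. E\<^sub>c q t X) ` Q) \<eta>"
    proof (rule ess_inf_exists)
      fix Z assume "Z \<in> (\<lambda>q. E\<^sub>c q t X) ` Q"
      then obtain p where p: "p \<in> Q" "Z = E\<^sub>c p t X" by blast
      show "Z \<in> borel_measurable M" using cond_exp_measurable[OF t' t(2)] p by simp
      have "AE x in M. - 1 \<le> X x \<and> X x \<le> 1" using X1 by eventually_elim auto
      from cond_exp_bounds[OF p(1) t' t(2) Xm this] show "AE x in M. \<bar>Z x\<bar> \<le> 1"
        unfolding p(2) by eventually_elim auto
    qed (use Q_ne in auto)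
    then show ?thesis using that by (auto simp: is_ess_inf_cond_exp_def)
  qed
  have b: "is_ess_inf_cond_exp M F T Q (\<lambda>_. t) Z Z"
    unfolding is_ess_inf_cond_exp_def
  proof (rule is_ess_inf_AE_eq)
    fix W assume "W \<in> (\<lambda>q. E\<^sub>c q t Z) ` Q"
    then obtain p where p: "p \<in> Q" "W = E\<^sub>c p t Z" by blast
    interpret finite_measure_subalgebra p ?G by (rule cond_exp_subalgebra[OF p(1) t' t(2)])
    have "AE x in p. E\<^sub>c p t Z x = Z x"
      by (rule real_cond_exp_F_meas[OF integrable_Q[OF p(1) Zm Z\<delta>] ZG])
    then show "AE x in M. W x = Z x" using AE_Q[OF p(1)] p(2) by simp
  qed (use Q_ne Zm in auto)
  have const: "is_ess_inf_cond_exp M F T Q (\<lambda>_. 0) R (\<lambda>_. INF p\<in>Q. \<integral>x. R x \<partial>p)"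
    and lb: "bdd_below ((\<lambda>p. \<integral>x. R x \<partial>p) ` Q)"
    if R: "R \<in> borel_measurable M" "AE x in M. \<bar>R x\<bar> \<le> c" for R and c :: real
  proof -
    show lb: "bdd_below ((\<lambda>p. \<integral>x. R x \<partial>p) ` Q)"
    proof (rule bdd_belowI2)
      fix p assume p: "p \<in> Q"
      interpret p: prob_space p by (rule Q_prob[OF p])
      have "AE x in p. \<bar>R x\<bar> \<le> c" using R(2) AE_Q[OF p] by simp
      then have "AE x in p. - c \<le> R x" by eventually_elim simp
      then show "- c \<le> (\<integral>x. R x \<partial>p)"
        by (rule p.integral_ge_const[OF integrable_Q[OF p R]])
    qed
    show "is_ess_inf_cond_exp M F T Q (\<lambda>_. 0) R (\<lambda>_. INF p\<in>Q. \<integral>x. R x \<partial>p)"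
      unfolding is_ess_inf_cond_exp_def
      using cond_exp_time_0[OF _ R triv] by (intro is_ess_inf_const[OF Q_ne lb]) auto
  qed
  \<comment> \<open>On \<open>B \<inter> C\<close> the bound comes from \<open>q1\<close>, on the
    rest of \<open>B\<close> from \<open>q2\<close>; off \<open>B\<close> the sign is zero.\<close>
  have "AE x in M. a x \<le> Z x"
  proof -
    have *: "AE x in M. a x \<le> E\<^sub>c p t X x" if "p \<in> Q" for p
      using a that by (auto simp: is_ess_inf_cond_exp_def is_ess_inf_def)
    show ?thesis
      using *[OF q(1)] *[OF q(2)] condX[OF q(1)] condX[OF q(2)] condV[OF q(1)] condV[OF q(2)] AE_space
    proof eventually_elim
      case (elim x)
      have 1: "a x \<le> \<phi> C x * ((g1 x - g2 x) / 2)"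
        using elim(1,3,5) by (simp add: g1_def[symmetric] field_simps)
      have 2: "a x \<le> \<phi> C x * ((g2 x - g1 x) / 2)"
        using elim(2,4,6) by (simp add: g2_def[symmetric] field_simps)
      show ?case
      proof (cases "x \<in> B")
        case True
        then have "g1 x + 2 * \<delta> < g2 x" by (simp add: B_def)
        then show ?thesis using 1 2 True by (cases "x \<in> C") (auto simp: \<phi>_def Z_def)
      next
        case False
        then show ?thesis using 1 by (simp add: \<phi>_def Z_def)
      qed
    qed
  qed
  moreover have "ess_bounded M X" "ess_bounded M Z"
    using ess_bounded_AE_le[OF Xm X1] ess_bounded_AE_le[OF Zm Z\<delta>] .
  moreover have "stopping (\<lambda>_. t)" using stopping_max[OF stopping_zero t' t(2)] t' by simp
  \<comment> \<open>Time consistency carries the comparison of \<open>X\<close> and \<open>Z\<close>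
    from \<open>t\<close> back to time 0, where the essential infima are constants.\<close>
  ultimately have "AE x in M. (INF p\<in>Q. \<integral>x. X x \<partial>p) \<le> (INF p\<in>Q. \<integral>x. Z x \<partial>p)"
    using tc[unfolded time_consistent_def, rule_format, of "\<lambda>_. 0" "\<lambda>_. t" X Z a Z]
      a b const[OF Xm X1] const[OF Zm Z\<delta>] stopping_zero t' by blast
  then have "(INF p\<in>Q. \<integral>x. X x \<partial>p) \<le> (INF p\<in>Q. \<integral>x. Z x \<partial>p)" by simp
  also have "\<dots> \<le> (\<integral>x. Z x \<partial>q1)" by (rule cINF_lower[OF lb[OF Zm Z\<delta>] q(1)])
  also have "\<dots> = - \<kappa>"
    using BM sets_Q[OF q(1)] by (simp add: Z_def \<kappa>_def)
  finally have up: "(INF p\<in>Q. \<integral>x. X x \<partial>p) \<le> - \<kappa>" .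
  have "- \<kappa> / 4 \<le> (INF p\<in>Q. \<integral>x. X x \<partial>p)"
  proof (rule cINF_greatest[OF Q_ne])
    fix p assume p: "p \<in> Q"
    obtain k where k: "k \<in> K" "(\<integral>x. \<bar>D p x - D k x\<bar> \<partial>M) < \<kappa> / 8" using K(3)[OF p] by blast
    have kQ: "k \<in> Q" using k(1) K(2) by blast
    have EX: "(\<integral>x. X x \<partial>r) = (\<integral>x. D r x * X x \<partial>M)" if "r \<in> Q" for r
      by (rule integral_wrt_density[OF D(3,1,2) Xm]) (use that in auto)
    have iX: "integrable M (\<lambda>x. D r x * X x)" if "r \<in> Q" for r
      using bound_int[OF that Xm X1] integrable_wrt_density[OF D(3,1,2) Xm] that by blast
    have "(\<integral>x. X x \<partial>k) = (\<integral>x. 2 * (indicator C x * f k x) - f k x \<partial>M)"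
      unfolding EX[OF kQ] by (intro Bochner_Integration.integral_cong)
        (auto simp: X_def \<phi>_def f_def algebra_simps)
    also have "\<dots> = 2 * (\<integral>x. indicator C x * f k x \<partial>M) - (\<integral>x. f k x \<partial>M)"
      using integrable_mult_indicator[OF CM fi[OF kQ]] fi[OF kQ] by simp
    finally have 1: "\<bar>\<integral>x. X x \<partial>k\<bar> < \<kappa> / 8"
      using C(2)[rule_format, OF k(1)] by linarith
    have "\<bar>(\<integral>x. X x \<partial>p) - (\<integral>x. X x \<partial>k)\<bar> = \<bar>\<integral>x. D p x * X x - D k x * X x \<partial>M\<bar>"
      unfolding EX[OF p] EX[OF kQ] using iX[OF p] iX[OF kQ] by simp
    also have "\<dots> \<le> (\<integral>x. \<bar>D p x * X x - D k x * X x\<bar> \<partial>M)" by (rule integral_abs_bound)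
    also have "\<dots> \<le> (\<integral>x. \<bar>D p x - D k x\<bar> \<partial>M)"
    proof (rule integral_mono_AE)
      show "integrable M (\<lambda>x. \<bar>D p x * X x - D k x * X x\<bar>)" using iX[OF p] iX[OF kQ] by simp
      show "integrable M (\<lambda>x. \<bar>D p x - D k x\<bar>)" using integrable_D[OF p] integrable_D[OF kQ] by simp
      show "AE x in M. \<bar>D p x * X x - D k x * X x\<bar> \<le> \<bar>D p x - D k x\<bar>"
        using X1
      proof eventually_elim
        case (elim x)
        have "\<bar>D p x - D k x\<bar> * \<bar>X x\<bar> \<le> \<bar>D p x - D k x\<bar> * 1"
          using elim by (intro mult_left_mono) auto
        then show ?case by (simp add: abs_mult[symmetric] left_diff_distrib)
      qed
    qed
    finally show "- \<kappa> / 4 \<le> (\<integral>x. X x \<partial>p)" using 1 k(2) by linarith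
  qed
  then show False using up \<kappa> by linarith
qed

end

section \<open>The theorem\<close>

theorem theorem2p3:
  fixes M :: "'a measure" and F :: "real \<Rightarrow> 'a measure" and T :: real
    and Q :: "'a measure set" and Y :: "real \<Rightarrow> 'a \<Rightarrow> real"
    and d :: "'a measure \<Rightarrow> 'a measure \<Rightarrow> real"
    and D :: "'a measure \<Rightarrow> 'a \<Rightarrow> real"
  assumes P: "prob_space M"
    and T_pos: "0 < T"
    (* filtration on [0,T] *)
    and F_sub: "\<forall>t\<in>{0..T}. subalgebra M (F t)"
    and F_mono: "\<forall>s t. 0 \<le> s \<and> s \<le> t \<and> t \<le> T \<longrightarrow> sets (F s) \<subseteq> sets (F t)"
    and F_rcont: "\<forall>t\<in>{0..<T}. sets (F t) = (\<Inter>s\<in>{t<..T}. sets (F s))"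
    and F_T: "sets (F T) = sets M"
    and F_0_triv: "\<forall>A\<in>sets (F 0). measure M A = 0 \<or> measure M A = 1"
    and F_0_null: "\<forall>A\<in>sets M. measure M A = 0 \<longrightarrow> A \<in> sets (F 0)"
    (* the set Q *)
    and Q_ne: "Q \<noteq> {}"
    and Q_prob: "\<forall>q\<in>Q. prob_space q \<and> sets q = sets M \<and> absolutely_continuous M q"
    (* the process Y *)
    and Y_adapted: "\<forall>t\<in>{0..T}. Y t \<in> borel_measurable (F t)"
    and Y_rcont: "\<forall>\<omega>\<in>space M. \<forall>t\<in>{0..<T}. ((\<lambda>s. Y s \<omega>) \<longlongrightarrow> Y t \<omega>) (at_right t)"
    and Y_bdd: "\<forall>\<omega>\<in>space M. bounded ((\<lambda>t. Y t \<omega>) ` {0..T})"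
    and Y_qlusc: "\<forall>\<tau>s \<tau>. (\<forall>n. is_stopping_time M F T (\<tau>s n)) \<and> is_stopping_time M F T \<tau> \<and>
         (\<forall>\<omega>\<in>space M. incseq (\<lambda>n. \<tau>s n \<omega>) \<and> (\<lambda>n. \<tau>s n \<omega>) \<longlonglongrightarrow> \<tau> \<omega>) \<longrightarrow>
         (AE \<omega> in M. limsup (\<lambda>n. ereal (Y (\<tau>s n \<omega>) \<omega>)) \<le> ereal (Y (\<tau> \<omega>) \<omega>))"
    (* hypotheses of the theorem *)
    and atomless: "\<forall>t\<in>{0<..T}. atomless_measure (restr_to_subalg M (F t))"
    and Ystar_L1: "(\<forall>q\<in>Q. integrable q (\<lambda>\<omega>. SUP t\<in>{0..T}. \<bar>Y t \<omega>\<bar>)) \<and>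
         bdd_above ((\<lambda>q. \<integral>\<omega>. \<bar>SUP t\<in>{0..T}. \<bar>Y t \<omega>\<bar>\<bar> \<partial>q) ` Q)"
    and Ystar_UI: "((\<lambda>a::real. SUP q\<in>Q. \<integral>\<omega>. (SUP t\<in>{0..T}. \<bar>Y t \<omega>\<bar>) *
         indicator {\<omega>. (SUP t\<in>{0..T}. \<bar>Y t \<omega>\<bar>) > a} \<omega> \<partial>q) \<longlongrightarrow> 0) at_top"
    and d_semimetric: "\<forall>q1\<in>Q. \<forall>q2\<in>Q. \<forall>q3\<in>Q. d q1 q1 = 0 \<and> 0 \<le> d q1 q2 \<and>
         d q1 q2 = d q2 q1 \<and> d q1 q3 \<le> d q1 q2 + d q2 q3"
    and d_totally_bounded: "\<forall>e>0. \<exists>K. finite K \<and> K \<subseteq> Q \<and>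
         Q \<subseteq> (\<Union>k\<in>K. {q\<in>Q. d k q < e})"
    and D_density: "\<forall>q\<in>Q. D q \<in> borel_measurable M \<and> (\<forall>\<omega>\<in>space M. 0 \<le> D q \<omega>) \<and>
         q = density M (\<lambda>\<omega>. ennreal (D q \<omega>))"
    and D_unif_cont: "AE \<omega> in M. \<forall>e>0. \<exists>\<delta>>0. \<forall>q1\<in>Q. \<forall>q2\<in>Q.
         d q1 q2 < \<delta> \<longrightarrow> \<bar>D q1 \<omega> - D q2 \<omega>\<bar> < e"
    and D_dominated: "\<exists>h. integrable M h \<and> (AE \<omega> in M. \<forall>q\<in>Q. \<bar>D q \<omega>\<bar> \<le> h \<omega>)"
  shows "(SUP \<tau>\<in>{\<tau>. is_stopping_time M F T \<tau>}. INF q\<in>Q. \<integral>\<omega>. Y (\<tau> \<omega>) \<omega> \<partial>q)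
           = (SUP \<tau>\<in>{\<tau>. is_stopping_time M F T \<tau>}. INF q\<in>co_measures M Q. \<integral>\<omega>. Y (\<tau> \<omega>) \<omega> \<partial>q)
       \<and> (SUP \<tau>\<in>{\<tau>. is_stopping_time M F T \<tau>}. INF q\<in>co_measures M Q. \<integral>\<omega>. Y (\<tau> \<omega>) \<omega> \<partial>q)
           = (INF q\<in>co_measures M Q. SUP \<tau>\<in>{\<tau>. is_stopping_time M F T \<tau>}. \<integral>\<omega>. Y (\<tau> \<omega>) \<omega> \<partial>q)
       \<and> ((\<forall>t\<in>{0<..T}. weakly_separable_L1 (restr_to_subalg M (F t))) \<longrightarrow>
           (\<exists>q1\<in>Q. \<exists>q2\<in>Q. q1 \<noteq> q2) \<longrightarrow>
           (\<forall>q\<in>Q. absolutely_continuous M q \<and> absolutely_continuous q M) \<longrightarrow>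
           \<not> time_consistent M F T Q)"
proof -
  interpret prob_space M by (rule P)
  interpret adapted_process M F T Y
    using T_pos F_sub F_mono Y_adapted Y_rcont Y_bdd by unfold_locales
  have Ys: "(\<lambda>\<omega>. SUP t\<in>{0..T}. \<bar>Y t \<omega>\<bar>) = Ystar"
    by (rule ext) (simp add: Ystar_def)
  note L1 = Ystar_L1[unfolded Ys] and UI = Ystar_UI[folded Ystar_def]
  have prob: "prob_space q" if "q \<in> Q" for q using Q_prob that by blast
  have D: "D q \<in> borel_measurable M" "\<forall>x\<in>space M. 0 \<le> D q x" "q = density M (\<lambda>x. ennreal (D q x))"
    if "q \<in> Q" for q
    using D_density that by blast+
  obtain h where h: "integrable M h" "AE \<omega> in M. \<forall>q\<in>Q. \<bar>D q \<omega>\<bar> \<le> h \<omega>"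
    using D_dominated by blast
  have int: "integrable q Ystar" if "q \<in> Q" for q using L1 that by blast
  obtain C where C': "\<And>q. q \<in> Q \<Longrightarrow> (\<integral>\<omega>. \<bar>Ystar \<omega>\<bar> \<partial>q) \<le> C"
    using L1 by (auto simp: bdd_above_def Ystar_def)
  have C: "(\<integral>\<omega>. Ystar \<omega> \<partial>q) \<le> C" if "q \<in> Q" for q
    using C'[OF that] integral_abs_bound[of q Ystar] by linarith
  note * = Q_ne prob D d_totally_bounded D_unif_cont h int C UI atomless
  show ?thesis
  proof (intro conjI impI)
    show "(SUP \<tau>\<in>{\<tau>. stopping \<tau>}. INF q\<in>Q. \<integral>\<omega>. Y (\<tau> \<omega>) \<omega> \<partial>q)
        = (SUP \<tau>\<in>{\<tau>. stopping \<tau>}. INF q\<in>co_measures M Q. \<integral>\<omega>. Y (\<tau> \<omega>) \<omega> \<partial>q)"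
      by (rule sup_inf_co_measures[OF *])
    show "(SUP \<tau>\<in>{\<tau>. stopping \<tau>}. INF q\<in>co_measures M Q. \<integral>\<omega>. Y (\<tau> \<omega>) \<omega> \<partial>q)
        = (INF q\<in>co_measures M Q. SUP \<tau>\<in>{\<tau>. stopping \<tau>}. \<integral>\<omega>. Y (\<tau> \<omega>) \<omega> \<partial>q)"
      by (rule stopping_minimax[OF *])
  next
    assume "\<exists>q1\<in>Q. \<exists>q2\<in>Q. q1 \<noteq> q2" and eq: "\<forall>q\<in>Q. absolutely_continuous M q \<and> absolutely_continuous q M"
    then obtain q1 q2 where q: "q1 \<in> Q" "q2 \<in> Q" "q1 \<noteq> q2" by blast
    interpret equivalent_measures M F T Q D
    proof (intro equivalent_measures.intro filtered_prob_space_axioms equivalent_measures_axioms.intro)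
      fix q assume q: "q \<in> Q"
      show "prob_space q" by (rule prob[OF q])
      show "D q \<in> borel_measurable M" "\<forall>x\<in>space M. 0 \<le> D q x"
        "q = density M (\<lambda>x. ennreal (D q x))" by (rule D[OF q])+
      show "absolutely_continuous M q" "absolutely_continuous q M" using bspec[OF eq q] by simp_all
    qed
    obtain t A where t: "t \<in> {0<..T}" and A: "A \<in> sets M"
      and ne: "\<not> (AE x in M. E\<^sub>c q1 t (indicator A) x = E\<^sub>c q2 t (indicator A) x)"
      using distinct_conditional_probabilities[OF q F_rcont F_0_triv F_0_null] by (elim bexE)
    have net: "\<exists>K. finite K \<and> K \<subseteq> Q \<and> (\<forall>q\<in>Q. \<exists>k\<in>K. (\<integral>x. \<bar>D q x - D k x\<bar> \<partial>M) < e)" if "0 < e" for e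
      using finite_L1_net[OF Q_ne integrable_D d_totally_bounded D_unif_cont h that] by blast
    \<comment> \<open>Kept free in the ordered pair: failure of almost sure equality only says that
      at least one of the two one-sided inequalities fails.\<close>
    have gap: "\<not> time_consistent M F T Q"
      if "p \<in> Q" "q \<in> Q" "\<not> (AE x in M. E\<^sub>c q t (indicator A) x \<le> E\<^sub>c p t (indicator A) x)" for p q
      using not_time_consistent_if_conditional_gap[OF that(1,2) _ _ A that(3) _ F_0_triv net] t atomless
      by simp
    show "\<not> time_consistent M F T Q"
    proof (cases "AE x in M. E\<^sub>c q2 t (indicator A) x \<le> E\<^sub>c q1 t (indicator A) x")
      case True
      have "\<not> (AE x in M. E\<^sub>c q1 t (indicator A) x \<le> E\<^sub>c q2 t (indicator A) x)"
      proof
        assume "AE x in M. E\<^sub>c q1 t (indicator A) x \<le> E\<^sub>c q2 t (indicator A) x"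
        with True have "AE x in M. E\<^sub>c q1 t (indicator A) x = E\<^sub>c q2 t (indicator A) x"
          by eventually_elim simp
        then show False using ne by blast
      qed
      then show ?thesis by (rule gap[OF q(2,1)])
    next
      case False
      then show ?thesis by (rule gap[OF q(1,2)])
    qed
  qed
qed

end
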